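(* Let $n\ge 3$, let $\mathbb{F}$ be a field and let $A=\{\dots,A_{-3},A_1,A_5,\dots\}$ be a non-degenerate PolyPoint in the projective plane over $\mathbb{F}$, indexed by the integers congruent to $1$ mod $4$, with monodromy $T$ (so $T(A_j)=A_{j+4n}$ for all $j$). Let $x_1,\dots,x_{2n}$ be its projective invariants: $x_i=p_i(A)$ for $i$ odd and $x_i=q_i(A)$ for $i$ even. Then the monodromy invariants $\Omega_1=\Omega_1(T)$ and $\Omega_2=\Omega_2(T)$ are given by $$\Omega_1=\frac{\left(\sum_{k=0}^{\lfloor n/2\rfloor} O_k\right)^3}{O_n^2E_n},\qquad \Omega_2=\frac{\left(\sum_{k=0}^{\lfloor n/2\rfloor} E_k\right)^3}{E_n^2O_n},$$ where $O_k,E_k$ are the pentagram invariants evaluated at $(x_1,\dots,x_{2n})$.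
   Context: PolyPoints. A PolyPoint is a bi-infinite sequence $A=\{A_j\}$ of points of the projective plane over $\mathbb{F}$, indexed by the integers $j\equiv 1$ mod $4$, for which there is a projective transformation $T$ (the monodromy) with $T(A_j)=A_{j+4n}$ for all $j$. For distinct points $a,a'$, $(aa')$ is the line through them; for distinct lines $b,b'$, $(bb')$ is their intersection point. For $j\equiv 3$ mod $4$ put $B_j=(A_{j-2}A_{j+2})$. Non-degenerate means: among any five consecutive points of $A$ no three are collinear. Invariants. For four points on a projective line (in an affine coordinate) put $x(a,b,c,d)=\frac{(a-b)(c-d)}{(a-c)(b-d)}$. For $j\equiv1$ mod $4$ define $$p_{(j+1)/2}(A)=x\big(A_{j+8},A_{j+4},(B_{j+6}B_{j-2}),(B_{j+6}B_{j-6})\big),\qquad q_{(j-1)/2}(A)=x\big(A_{j-8},A_{j-4},(B_{j-6}B_{j+2}),(B_{j-6}B_{j+6})\big).$$ So $p_i$ is defined for odd $i$, $q_i$ for even $i$, and they are $2n$-periodic in $i$. Monodromy invariants. For a projective transformation $T$ with linear lift $\widetilde T$, $\Omega_1(T)=\mathrm{tr}(\widetilde T)^3/\det(\widetilde T)$, and $\Omega_2(T)=\Omega_1(T^* )$, where $T^*$ is the projective transformation of the dual plane (the plane of lines) induced by $T$, with lift the inverse transpose of $\widetilde T$. Pentagram invariants. Indices lie in $\{1,\dots,2n\}$, taken cyclically mod $2n$. An odd unit is a set $\{j\}$ with $j$ odd, or $\{k-1,k,k+1\}$ with $k$ even. Two odd units are consecutive if the odd numbers in their union form a set of (cyclically)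 consecutive odd numbers. An odd admissible subset $S$ is a nonempty union of odd units no two of which are consecutive; its weight is the number of its units, and $\mathrm{sign}(S)=+1$ or $-1$ according to whether the number of singleton units is even or odd. For $1\le k\le\lfloor n/2\rfloor$, $O_k=\sum_S \mathrm{sign}(S)\prod_{j\in S}x_j$ over odd admissible $S$ of weight $k$; also $O_0=1$ and $O_n=x_1x_3\cdots x_{2n-1}$. The $E_k$ are defined in the same way with the words odd and even interchanged ($E_0=1$, $E_n=x_2x_4\cdots x_{2n}$). *)

theory Defs
  imports "HOL-Analysis.Analysis"
begin

section \<open>The projective plane over a field\<close>

text \<open>
  Points and lines of the projective plane over \<open>'a\<close> are the one- and two-dimensional
  linear subspaces of \<open>'a^3\<close>; incidence is inclusion. Consequently the line through two distinct
  points is the span of their union, and the common point of two distinct lines is their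
  intersection.
\<close>

definition proj_point :: "('a::field ^ 3) set \<Rightarrow> bool" where
  "proj_point a \<longleftrightarrow> vec.subspace a \<and> vec.dim a = 1"

definition proj_line :: "('a::field ^ 3) set \<Rightarrow> bool" where
  "proj_line l \<longleftrightarrow> vec.subspace l \<and> vec.dim l = 2"

definition join :: "('a::field ^ 3) set \<Rightarrow> ('a ^ 3) set \<Rightarrow> ('a ^ 3) set" where
  "join a a' = vec.span (a \<union> a')"

definition meet :: "('a::field ^ 3) set \<Rightarrow> ('a ^ 3) set \<Rightarrow> ('a ^ 3) set" where
  "meet b b' = b \<inter> b'"

definition proj_collinear ::
    "('a::field ^ 3) set \<Rightarrow> ('a ^ 3) set \<Rightarrow> ('a ^ 3) set \<Rightarrow> bool" where
  "proj_collinear a b c \<longleftrightarrow> (\<exists>l. proj_line l \<and> a \<subseteq> l \<and> b \<subseteq> l \<and> c \<subseteq> l)"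

text \<open>
  A map on points is a projective transformation if it has an invertible linear lift. Only its
  values on actual points matter.
\<close>

definition is_lift :: "'a::field ^ 3 ^ 3 \<Rightarrow> (('a ^ 3) set \<Rightarrow> ('a ^ 3) set) \<Rightarrow> bool" where
  "is_lift M T \<longleftrightarrow> invertible M \<and> (\<forall>a. proj_point a \<longrightarrow> T a = (\<lambda>v. M *v v) ` a)"

definition proj_transformation :: "(('a::field ^ 3) set \<Rightarrow> ('a ^ 3) set) \<Rightarrow> bool" where
  "proj_transformation T \<longleftrightarrow> (\<exists>M. is_lift M T)"

text \<open>
  A point of the dual plane is represented by a one-dimensional space of coefficient vectors of
  linear forms; the line of the original plane it stands for is its annihilator. A projective
  transformation acts on lines pointwise, which gives its action on the dual plane. Lemma
  \<open>is_lift_dual\<close> below confirms that the inverse transpose is a lift of this action.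
\<close>

definition annihilator :: "('a::field ^ 3) set \<Rightarrow> ('a ^ 3) set" where
  "annihilator X = {\<xi>. \<forall>v\<in>X. (\<Sum>i\<in>UNIV. \<xi> $ i * v $ i) = 0}"

definition dual_transformation ::
    "(('a::field ^ 3) set \<Rightarrow> ('a ^ 3) set) \<Rightarrow> ('a ^ 3) set \<Rightarrow> ('a ^ 3) set" where
  "dual_transformation T l =
     annihilator (\<Union>a \<in> {a. proj_point a \<and> a \<subseteq> annihilator l}. T a)"

text \<open>The following value does not depend on the choice of the lift, see \<open>Omega1_eq\<close>.\<close>

definition Omega1 :: "(('a::field ^ 3) set \<Rightarrow> ('a ^ 3) set) \<Rightarrow> 'a" where
  "Omega1 T = (THE w. \<exists>M. is_lift M T \<and> w = trace M ^ 3 / det M)"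

definition Omega2 :: "(('a::field ^ 3) set \<Rightarrow> ('a ^ 3) set) \<Rightarrow> 'a" where
  "Omega2 T = Omega1 (dual_transformation T)"

lemma proj_point_span:
  fixes v :: "'a::field ^ 3"
  assumes "v \<noteq> 0"
  shows "proj_point (vec.span {v})"
proof -
  have "vec.dim (vec.span {v}) = 1"
    using assms by (simp add: vec.dim_eq_card_independent)
  then show ?thesis by (simp add: proj_point_def vec.subspace_span)
qed

lemma proj_pointE:
  fixes a :: "('a::field ^ 3) set"
  assumes "proj_point a"
  obtains v where "v \<noteq> 0" "a = vec.span {v}"
proof -
  obtain B where B: "B \<subseteq> a" "vec.independent B" "a \<subseteq> vec.span B" "card B = vec.dim a"
    using vec.basis_exists by metis
  with assms obtain v where v: "B = {v}"
    by (metis proj_point_def card_1_singletonE)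
  have "vec.span B = a"
    using B assms by (simp add: proj_point_def vec.span_subspace)
  moreover have "v \<noteq> 0" using B(2) v by simp
  ultimately show thesis using that v by blast
qed

lemma is_lift_span:
  assumes "is_lift M T" "v \<noteq> 0"
  shows "T (vec.span {v}) = vec.span {M *v v}"
proof -
  have "T (vec.span {v}) = (\<lambda>v. M *v v) ` vec.span {v}"
    using assms proj_point_span unfolding is_lift_def by blast
  also have "\<dots> = vec.span {M *v v}"
    by (auto simp: vec.span_singleton image_iff vec.scale)
  finally show ?thesis .
qed

lemma invertible_mult_nonzero:
  fixes M :: "'a::field ^ 3 ^ 3"
  assumes "invertible M" "v \<noteq> 0"
  shows "M *v v \<noteq> 0"
  using assms by (metis invertible_def matrix_vector_mul_assoc matrix_vector_mul_lid matrix_vector_mult_0_right)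

lemma all_eigenvectors_scalar:
  fixes K :: "'a::field ^ 3 ^ 3"
  assumes "\<And>v. v \<noteq> 0 \<Longrightarrow> \<exists>c. K *v v = c *s v"
  shows "\<exists>c. \<forall>v. K *v v = c *s v"
proof -
  have 1: "K *v axis i 1 = (K$i$i) *s axis i 1" for i
  proof -
    obtain c where c: "K *v axis i 1 = c *s axis i 1"
      using assms[of "axis i 1"] by (auto simp: axis_eq_0_iff)
    have "(K *v axis i 1)$i = K$i$i" by (simp add: matrix_vector_mul_component matrix_vector_mult_def axis_def if_distrib cong: if_cong)
    moreover have "(c *s axis i (1::'a))$i = c" by (simp add: axis_def)
    ultimately show ?thesis using c by simp
  qed
  have off: "K$j$i = 0" if "i \<noteq> j" for i j
  proof -
    have "(K *v axis i 1)$j = K$j$i" by (simp add: matrix_vector_mult_def axis_def if_distrib cong: if_cong)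
    then show ?thesis using 1[of i] that by (simp add: axis_def)
  qed
  have comp: "(K *v v)$i = K$i$i * v$i" for v i
  proof -
    have "(K *v v)$i = (\<Sum>j\<in>UNIV. K$i$j * v$j)" by (simp add: matrix_vector_mult_def)
    also have "\<dots> = (\<Sum>j\<in>UNIV. if j = i then K$i$i * v$i else 0)"
      by (rule sum.cong) (auto simp: off)
    finally show ?thesis by simp
  qed
  obtain c where c: "K *v (\<chi> i. 1) = c *s (\<chi> i. 1)"
    using assms[of "\<chi> i. 1"] by (metis vec_lambda_beta zero_index zero_neq_one)
  have "K$i$i = c" for i
    using comp[of "\<chi> i. 1" i] c by simp
  then show ?thesis using comp by (intro exI[of _ c]) (auto simp: vec_eq_iff)
qed

lemma is_lift_unique:
  assumes M: "is_lift M T" and N: "is_lift N T"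
  obtains c where "c \<noteq> 0" "M = (\<chi> i j. c * N $ i $ j)"
proof -
  obtain N' where N': "N ** N' = mat 1" "N' ** N = mat 1"
    using N unfolding is_lift_def invertible_def by blast
  have "\<exists>c. (N' ** M) *v v = c *s v" if "v \<noteq> 0" for v
  proof -
    have "vec.span {M *v v} = vec.span {N *v v}"
      using is_lift_span[OF M that] is_lift_span[OF N that] by simp
    then have "M *v v \<in> vec.span {N *v v}" using vec.span_base[of "M *v v" "{M *v v}"] by auto
    then obtain c where "M *v v = c *s (N *v v)" by (auto simp: vec.span_singleton)
    then have "(N' ** M) *v v = c *s ((N' ** N) *v v)"
      by (simp add: vec.scale flip: matrix_vector_mul_assoc)
    then show ?thesis using N' by auto
  qed
  then obtain c where c: "\<And>v. (N' ** M) *v v = c *s v"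
    using all_eigenvectors_scalar by blast
  have Mv: "M *v v = c *s (N *v v)" for v
  proof -
    have "M *v v = (N ** N') *v (M *v v)" using N' by simp
    also have "\<dots> = N *v ((N' ** M) *v v)" by (simp add: matrix_vector_mul_assoc matrix_mul_assoc)
    finally show ?thesis using c by (simp add: vec.scale)
  qed
  have "M = (\<chi> i j. c * N $ i $ j)"
  proof (rule matrix_eq[THEN iffD2], rule allI)
    fix v :: "'a ^ 3"
    show "M *v v = (\<chi> i j. c * N $ i $ j) *v v"
      unfolding Mv by (simp add: vec_eq_iff matrix_vector_mult_def sum_distrib_left mult.assoc)
  qed
  moreover have "c \<noteq> 0"
  proof
    assume "c = 0"
    then have "M *v axis 1 1 = 0" using Mv by simp
    then show False
      using M invertible_mult_nonzero[of M "axis 1 1"] by (auto simp: is_lift_def axis_eq_0_iff)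
  qed
  ultimately show thesis using that by blast
qed

lemma Omega1_eq:
  assumes "is_lift M T"
  shows "Omega1 T = trace M ^ 3 / det M"
  unfolding Omega1_def
proof (rule the_equality)
  show "\<exists>N. is_lift N T \<and> trace M ^ 3 / det M = trace N ^ 3 / det N"
    using assms by blast
  fix w assume "\<exists>N. is_lift N T \<and> w = trace N ^ 3 / det N"
  then obtain N where N: "is_lift N T" "w = trace N ^ 3 / det N" by blast
  obtain c where c: "c \<noteq> 0" "N = (\<chi> i j. c * M $ i $ j)"
    using is_lift_unique[OF N(1) assms] .
  have "trace N = c * trace M" by (simp add: c trace_def sum_distrib_left)
  moreover have "det N = c ^ 3 * det M" by (simp add: c det_3 algebra_simps power3_eq_cube)
  ultimately show "w = trace M ^ 3 / det M" using c(1) N(2) by (simp add: power_mult_distrib)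
qed

lemma annihilator_annihilator:
  assumes "proj_point l"
  shows "annihilator (annihilator l) = l"
proof -
  obtain w where w: "w \<noteq> 0" "l = vec.span {w}" using assms by (rule proj_pointE)
  obtain i where i: "w $ i \<noteq> 0" using w(1) by (auto simp: vec_eq_iff)
  have "l \<subseteq> annihilator (annihilator l)"
    by (auto simp: annihilator_def mult.commute)
  moreover have "\<xi> \<in> l" if "\<xi> \<in> annihilator (annihilator l)" for \<xi>
  proof -
    have eq: "w $ i * \<xi> $ j = w $ j * \<xi> $ i" for j
    proof -
      define v where "v = w $ i *s axis j 1 - w $ j *s axis i 1"
      have s: "(\<Sum>k\<in>UNIV. u $ k * v $ k) = w $ i * u $ j - w $ j * u $ i" for u
      proof -
        have "(\<Sum>k\<in>UNIV. u $ k * v $ k) =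
            (\<Sum>k\<in>UNIV. (if k = j then w $ i * u $ k else 0) - (if k = i then w $ j * u $ k else 0))"
          by (rule sum.cong) (auto simp: v_def axis_def algebra_simps)
        then show ?thesis by (simp add: sum_subtractf)
      qed
      have "(\<Sum>k\<in>UNIV. v $ k * u $ k) = 0" if uL: "u \<in> l" for u
      proof -
        obtain c where "u = c *s w" using uL w by (auto simp: vec.span_singleton)
        then show ?thesis using s[of u] by (simp add: mult.commute mult.left_commute)
      qed
      then have "v \<in> annihilator l" by (simp add: annihilator_def)
      then have "(\<Sum>k\<in>UNIV. \<xi> $ k * v $ k) = 0"
        using that unfolding annihilator_def by blast
      with s show ?thesis by simp
    qed
    have "\<xi> = (\<xi> $ i / w $ i) *s w"
      using eq i by (simp add: vec_eq_iff field_simps)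
    then show ?thesis using w by (auto simp: vec.span_singleton)
  qed
  ultimately show ?thesis by blast
qed

lemma is_lift_dual:
  assumes "is_lift M T"
  shows "is_lift (transpose (matrix_inv M)) (dual_transformation T)"
  unfolding is_lift_def
proof (intro conjI allI impI)
  have M: "invertible M" using assms by (simp add: is_lift_def)
  define N where "N = matrix_inv M"
  have "M ** N = mat 1 \<and> N ** M = mat 1"
    unfolding N_def matrix_inv_def using M unfolding invertible_def by (rule someI_ex)
  then have N: "M ** N = mat 1" "N ** M = mat 1" by auto
  have tr: "transpose M ** transpose N = mat 1" "transpose N ** transpose M = mat 1"
    using N by (simp_all flip: matrix_transpose_mul)
  then show "invertible (transpose (matrix_inv M))"
    unfolding invertible_def N_def[symmetric] by blast
  fix l :: "('a ^ 3) set" assume l: "proj_point l"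
  let ?K = "annihilator l"
  have sub: "vec.subspace ?K"
    by (auto simp: annihilator_def vec.subspace_def algebra_simps sum.distrib simp flip: sum_distrib_left)
  have adj: "(\<Sum>i\<in>UNIV. \<xi> $ i * (M *v v) $ i) = (\<Sum>i\<in>UNIV. (transpose M *v \<xi>) $ i * v $ i)" for \<xi> v
    unfolding matrix_vector_mult_def transpose_def
    by (simp add: sum_distrib_left sum_distrib_right mult_ac) (rule sum.swap)
  have T: "T a = (\<lambda>v. M *v v) ` a" if "proj_point a" for a
    using assms that by (simp add: is_lift_def)
  have "dual_transformation T l = {\<xi>. \<forall>v\<in>?K. (\<Sum>i\<in>UNIV. \<xi> $ i * (M *v v) $ i) = 0}"
  proof -
    have "(\<Sum>i\<in>UNIV. \<xi> $ i * (M *v v) $ i) = 0"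
      if "\<xi> \<in> dual_transformation T l" "v \<in> ?K" for \<xi> v
    proof (cases "v = 0")
      case False
      have "vec.span {v} \<subseteq> ?K" using sub that(2) by (simp add: vec.span_minimal)
      then have "M *v v \<in> (\<Union>a \<in> {a. proj_point a \<and> a \<subseteq> ?K}. T a)"
        using proj_point_span[OF False] T vec.span_base[of v "{v}"] by blast
      then show ?thesis using that(1) unfolding dual_transformation_def annihilator_def[of "\<Union>_"] by blast
    qed simp
    moreover have "\<xi> \<in> dual_transformation T l"
      if "\<forall>v\<in>?K. (\<Sum>i\<in>UNIV. \<xi> $ i * (M *v v) $ i) = 0" for \<xi>
    proof -
      have "(\<Sum>i\<in>UNIV. \<xi> $ i * u $ i) = 0"
        if "proj_point a" "a \<subseteq> ?K" "u \<in> T a" for a u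
        using that T[of a] \<open>\<forall>v\<in>?K. _ v\<close> by auto
      then show ?thesis unfolding dual_transformation_def annihilator_def[of "\<Union>_"] by blast
    qed
    ultimately show ?thesis by blast
  qed
  also have "\<dots> = {\<xi>. transpose M *v \<xi> \<in> annihilator ?K}"
    unfolding adj by (simp only: annihilator_def[of ?K] mem_Collect_eq)
  also have "\<dots> = {\<xi>. transpose M *v \<xi> \<in> l}"
    using annihilator_annihilator[OF l] by simp
  also have "\<dots> = (\<lambda>v. transpose N *v v) ` l"
  proof -
    have 1: "transpose N *v (transpose M *v \<xi>) = \<xi>" "transpose M *v (transpose N *v \<xi>) = \<xi>" for \<xi>
      using tr by (simp_all only: matrix_vector_mul_assoc matrix_vector_mul_lid)
    show ?thesis
    proof (intro set_eqI iffI)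
      fix \<xi> assume "\<xi> \<in> {\<xi>. transpose M *v \<xi> \<in> l}"
      then show "\<xi> \<in> (\<lambda>v. transpose N *v v) ` l" using 1(1)[of \<xi>] by (metis mem_Collect_eq image_eqI)
    next
      fix \<xi> assume "\<xi> \<in> (\<lambda>v. transpose N *v v) ` l"
      then show "\<xi> \<in> {\<xi>. transpose M *v \<xi> \<in> l}" using 1(2) by auto
    qed
  qed
  finally show "dual_transformation T l = (\<lambda>v. transpose (matrix_inv M) *v v) ` l"
    by (simp add: N_def)
qed

lemma Omega2_eq:
  assumes "is_lift M T"
  shows "Omega2 T = trace (transpose (matrix_inv M)) ^ 3 / det (transpose (matrix_inv M))"
  unfolding Omega2_def using Omega1_eq[OF is_lift_dual[OF assms]] .

text \<open>
  For independent \<open>e\<close> and \<open>f\<close>, the points of the line spanned by \<open>e\<close> and \<open>f\<close> other than the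
  point of \<open>e\<close> are \<open>affine_point e f t\<close> for exactly one \<open>t\<close>, and every affine coordinate on a
  projective line arises like this. The invariant is independent of the coordinate, see
  \<open>inverse_cross_ratio_eq\<close>; it is only used where the denominator is nonzero.
\<close>

definition affine_point :: "'a::field ^ 3 \<Rightarrow> 'a ^ 3 \<Rightarrow> 'a \<Rightarrow> ('a ^ 3) set" where
  "affine_point e f t = vec.span {f + t *s e}"

definition inverse_cross_ratio ::
    "('a::field ^ 3) set \<Rightarrow> ('a ^ 3) set \<Rightarrow> ('a ^ 3) set \<Rightarrow> ('a ^ 3) set \<Rightarrow> 'a" where
  "inverse_cross_ratio a b c d =
     (THE x. \<exists>e f \<alpha> \<beta> \<gamma> \<delta>. e \<noteq> f \<and> vec.independent {e, f} \<and>
        a = affine_point e f \<alpha> \<and> b = affine_point e f \<beta> \<and>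
        c = affine_point e f \<gamma> \<and> d = affine_point e f \<delta> \<and>
        x = ((\<alpha> - \<beta>) * (\<gamma> - \<delta>)) / ((\<alpha> - \<gamma>) * (\<beta> - \<delta>)))"

lemma independent_pair_bracket:
  fixes e f :: "'a::field ^ 3"
  assumes "e \<noteq> f" "vec.independent {e, f}"
  obtains j k where "e $ j * f $ k - e $ k * f $ j \<noteq> 0"
proof -
  have "e \<noteq> 0" using assms(2) vec.dependent_zero[of "{e, f}"] by auto
  then obtain j where j: "e $ j \<noteq> 0" by (auto simp: vec_eq_iff)
  have "\<exists>k. e $ j * f $ k - e $ k * f $ j \<noteq> 0"
  proof (rule ccontr)
    assume "\<not> ?thesis"
    then have eq: "e $ j * f $ k = e $ k * f $ j" for k by simp
    have "f $ k = (f $ j / e $ j) * e $ k" for k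
      using eq[of k] j by (simp add: nonzero_eq_divide_eq mult.commute)
    then have "f = (f $ j / e $ j) *s e"
      unfolding vec_eq_iff vector_smult_component by blast
    then have "f \<in> vec.span {e}" unfolding vec.span_singleton by (rule range_eqI)
    then show False using assms vec.independent_insert[of f "{e}"] by (simp add: insert_commute[of e f])
  qed
  then show thesis using that by blast
qed

lemma affine_point_nonzero:
  fixes e f :: "'a::field ^ 3"
  assumes "e \<noteq> f" "vec.independent {e, f}"
  shows "f + t *s e \<noteq> 0"
proof
  assume 0: "f + t *s e = 0"
  obtain j k where jk: "e $ j * f $ k - e $ k * f $ j \<noteq> 0" using independent_pair_bracket[OF assms] .
  have "f = - t *s e" using 0 by (simp add: add_eq_0_iff)
  then show False using jk by (simp add: algebra_simps)
qed

lemma inverse_cross_ratio_eq: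
  fixes e f :: "'a::field ^ 3"
  assumes "e \<noteq> f" "vec.independent {e, f}"
  shows "inverse_cross_ratio (affine_point e f \<alpha>) (affine_point e f \<beta>)
           (affine_point e f \<gamma>) (affine_point e f \<delta>) =
         ((\<alpha> - \<beta>) * (\<gamma> - \<delta>)) / ((\<alpha> - \<gamma>) * (\<beta> - \<delta>))"
  unfolding inverse_cross_ratio_def
proof (rule the_equality, goal_cases)
  case 1
  show ?case using assms by blast
next
  case (2 w)
  then obtain e' f' \<alpha>' \<beta>' \<gamma>' \<delta>' where ind: "e' \<noteq> f'" "vec.independent {e', f'}"
    and pts: "affine_point e f \<alpha> = affine_point e' f' \<alpha>'" "affine_point e f \<beta> = affine_point e' f' \<beta>'"
      "affine_point e f \<gamma> = affine_point e' f' \<gamma>'" "affine_point e f \<delta> = affine_point e' f' \<delta>'"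
    and w: "w = ((\<alpha>' - \<beta>') * (\<gamma>' - \<delta>')) / ((\<alpha>' - \<gamma>') * (\<beta>' - \<delta>'))"
    by (elim exE conjE) (rule that)
  obtain j k where jk: "e $ j * f $ k - e $ k * f $ j \<noteq> 0" using independent_pair_bracket[OF assms] .
  define D where "D u v = u $ j * v $ k - u $ k * v $ j" for u v :: "'a ^ 3"
  have D_aff: "D (f + s *s e) (f + t *s e) = (s - t) * D e f" for s t and e f :: "'a ^ 3"
    by (simp add: D_def algebra_simps)
  have D_scale: "D (s *s u) (t *s v) = s * t * D u v" for s t u v
    by (simp add: D_def algebra_simps)
  have D0: "D e f \<noteq> 0" using jk by (simp add: D_def)
  have lam: "\<exists>c. c \<noteq> 0 \<and> f' + t' *s e' = c *s (f + t *s e)"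
    if "affine_point e f t = affine_point e' f' t'" for t t'
  proof -
    have "f' + t' *s e' \<in> vec.span {f + t *s e}"
      using that vec.span_base[of "f' + t' *s e'" "{f' + t' *s e'}"] by (simp add: affine_point_def)
    then obtain c where "f' + t' *s e' = c *s (f + t *s e)" by (auto simp: vec.span_singleton)
    moreover have "c \<noteq> 0" using calculation affine_point_nonzero[OF ind, of t'] by auto
    ultimately show ?thesis by blast
  qed
  obtain a b c d where
    nz: "a \<noteq> 0" "b \<noteq> 0" "c \<noteq> 0" "d \<noteq> 0" and
    eq: "f' + \<alpha>' *s e' = a *s (f + \<alpha> *s e)" "f' + \<beta>' *s e' = b *s (f + \<beta> *s e)"
      "f' + \<gamma>' *s e' = c *s (f + \<gamma> *s e)" "f' + \<delta>' *s e' = d *s (f + \<delta> *s e)"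
    using lam[OF pts(1)] lam[OF pts(2)] lam[OF pts(3)] lam[OF pts(4)] by blast
  define h where "h = D e' f' / D e f"
  have tr: "(s' - t') * h = p * q * (s - t)"
    if "f' + s' *s e' = p *s (f + s *s e)" "f' + t' *s e' = q *s (f + t *s e)" for s t s' t' p q
  proof -
    have "(s' - t') * D e' f' = p * q * ((s - t) * D e f)"
      using D_aff[of f' s' e' t'] D_scale[of p "f + s *s e" q "f + t *s e"] D_aff[of f s e t]
      by (simp add: that)
    then show ?thesis using D0 by (simp add: h_def field_simps)
  qed
  have r: "(\<alpha>' - \<beta>') * h = a * b * (\<alpha> - \<beta>)" "(\<gamma>' - \<delta>') * h = c * d * (\<gamma> - \<delta>)"
    "(\<alpha>' - \<gamma>') * h = a * c * (\<alpha> - \<gamma>)" "(\<beta>' - \<delta>') * h = b * d * (\<beta> - \<delta>)"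
    using tr eq by blast+
  show ?case
  proof (cases "h = 0")
    case False
    have "w = (((\<alpha>' - \<beta>') * h) * ((\<gamma>' - \<delta>') * h)) / (((\<alpha>' - \<gamma>') * h) * ((\<beta>' - \<delta>') * h))"
      using False w by simp
    also have "\<dots> = ((\<alpha> - \<beta>) * (\<gamma> - \<delta>)) / ((\<alpha> - \<gamma>) * (\<beta> - \<delta>))"
      unfolding r using nz by simp
    finally show ?thesis .
  next
    case True
    then have eqs: "\<alpha> = \<beta>" "\<alpha> = \<gamma>" using r nz by auto
    have "affine_point e' f' \<alpha>' = affine_point e' f' \<gamma>'" using pts eqs by simp
    then have m: "f' + \<gamma>' *s e' \<in> vec.span {f' + \<alpha>' *s e'}"
      using vec.span_base[of "f' + \<gamma>' *s e'" "{f' + \<gamma>' *s e'}"] by (simp add: affine_point_def)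
    then obtain l where l: "f' + \<gamma>' *s e' = l *s (f' + \<alpha>' *s e')" by (auto simp: vec.span_singleton)
    obtain j' k' where jk': "e' $ j' * f' $ k' - e' $ k' * f' $ j' \<noteq> 0"
      using independent_pair_bracket[OF ind] .
    have "(\<gamma>' - \<alpha>') * (e' $ j' * f' $ k' - e' $ k' * f' $ j') =
        (f' + \<gamma>' *s e') $ j' * (f' + \<alpha>' *s e') $ k' - (f' + \<gamma>' *s e') $ k' * (f' + \<alpha>' *s e') $ j'"
      by (simp add: algebra_simps)
    also have "\<dots> = 0" unfolding l by (simp add: algebra_simps)
    finally have "\<alpha>' = \<gamma>'" using jk' by simp
    then show ?thesis using w eqs by simp
  qed
qed


section \<open>PolyPoints and their invariants\<close>

text \<open>
  A PolyPoint is indexed by the integers congruent to \<open>1\<close> modulo \<open>4\<close>; the values of \<open>A\<close> at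
  other integers are irrelevant, and \<open>poly_line A j\<close> is only meaningful for \<open>j\<close> congruent to \<open>3\<close>.
\<close>

definition polypoint ::
    "nat \<Rightarrow> (int \<Rightarrow> ('a::field ^ 3) set) \<Rightarrow> (('a ^ 3) set \<Rightarrow> ('a ^ 3) set) \<Rightarrow> bool" where
  "polypoint n A T \<longleftrightarrow> proj_transformation T \<and>
     (\<forall>j. j mod 4 = 1 \<longrightarrow> proj_point (A j) \<and> T (A j) = A (j + 4 * int n))"

definition nondegenerate :: "(int \<Rightarrow> ('a::field ^ 3) set) \<Rightarrow> bool" where
  "nondegenerate A \<longleftrightarrow>
     (\<forall>j. j mod 4 = 1 \<longrightarrow>
        (\<forall>r s t. 0 \<le> r \<and> r < s \<and> s < t \<and> t \<le> 4 \<longrightarrow>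
           \<not> proj_collinear (A (j + 4 * r)) (A (j + 4 * s)) (A (j + 4 * t))))"

definition poly_line :: "(int \<Rightarrow> ('a::field ^ 3) set) \<Rightarrow> int \<Rightarrow> ('a ^ 3) set" where
  "poly_line A j = join (A (j - 2)) (A (j + 2))"

text \<open>
  The corner invariants, reindexed: \<open>p_inv A i\<close> uses \<open>j = 2 * i - 1\<close>, i.e. \<open>i = (j + 1) / 2\<close>,
  and \<open>q_inv A i\<close> uses \<open>j = 2 * i + 1\<close>, i.e. \<open>i = (j - 1) / 2\<close>.
\<close>

definition p_inv :: "(int \<Rightarrow> ('a::field ^ 3) set) \<Rightarrow> int \<Rightarrow> 'a" where
  "p_inv A i = (let j = 2 * i - 1; B = poly_line A in
     inverse_cross_ratio (A (j + 8)) (A (j + 4))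
       (meet (B (j + 6)) (B (j - 2))) (meet (B (j + 6)) (B (j - 6))))"

definition q_inv :: "(int \<Rightarrow> ('a::field ^ 3) set) \<Rightarrow> int \<Rightarrow> 'a" where
  "q_inv A i = (let j = 2 * i + 1; B = poly_line A in
     inverse_cross_ratio (A (j - 8)) (A (j - 4))
       (meet (B (j - 6)) (B (j + 2))) (meet (B (j - 6)) (B (j + 6))))"

definition proj_invariant :: "(int \<Rightarrow> ('a::field ^ 3) set) \<Rightarrow> nat \<Rightarrow> 'a" where
  "proj_invariant A i = (if odd i then p_inv A (int i) else q_inv A (int i))"


section \<open>Pentagram invariants\<close>

text \<open>
  \<open>cyc n i\<close> is the representative of \<open>i\<close> modulo \<open>2 * n\<close> in \<open>{1..2 * n}\<close>; the summand \<open>2 * n - 1\<close>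
  avoids truncated subtraction at \<open>i = 0\<close>. The parameter \<open>P\<close> is \<open>odd\<close> or \<open>even\<close>.
\<close>

definition cyc :: "nat \<Rightarrow> nat \<Rightarrow> nat" where
  "cyc n i = (i + (2 * n - 1)) mod (2 * n) + 1"

definition pent_unit :: "(nat \<Rightarrow> bool) \<Rightarrow> nat \<Rightarrow> nat set \<Rightarrow> bool" where
  "pent_unit P n u \<longleftrightarrow>
     (\<exists>j\<in>{1..2 * n}. P j \<and> u = {j}) \<or>
     (\<exists>k\<in>{1..2 * n}. \<not> P k \<and> u = {cyc n (k - 1), k, cyc n (k + 1)})"

definition consecutive_units :: "(nat \<Rightarrow> bool) \<Rightarrow> nat \<Rightarrow> nat set \<Rightarrow> nat set \<Rightarrow> bool" where
  "consecutive_units P n u v \<longleftrightarrow>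
     (\<exists>s\<in>{1..2 * n}. \<exists>m. P s \<and> {i \<in> u \<union> v. P i} = (\<lambda>t. cyc n (s + 2 * t)) ` {..<m})"

definition unit_decomposition :: "(nat \<Rightarrow> bool) \<Rightarrow> nat \<Rightarrow> nat set set \<Rightarrow> nat set \<Rightarrow> bool" where
  "unit_decomposition P n U S \<longleftrightarrow>
     U \<noteq> {} \<and> (\<forall>u\<in>U. pent_unit P n u) \<and>
     (\<forall>u\<in>U. \<forall>v\<in>U. u \<noteq> v \<longrightarrow> \<not> consecutive_units P n u v) \<and> S = \<Union>U"

definition pent_admissible :: "(nat \<Rightarrow> bool) \<Rightarrow> nat \<Rightarrow> nat set \<Rightarrow> bool" where
  "pent_admissible P n S \<longleftrightarrow> (\<exists>U. unit_decomposition P n U S)"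

lemma unit_decomposition_unique:
  assumes P: "P = odd \<or> P = even" and n: "n \<ge> 1"
    and U: "unit_decomposition P n U S" and V: "unit_decomposition P n V S"
  shows "U = V"
proof -
  have ev: "even (cyc n i) = even i" for i
  proof -
    have "even ((i + (2 * n - 1)) mod (2 * n)) = even (i + (2 * n - 1))"
      by (simp add: dvd_mod_iff)
    also have "\<dots> = odd i" using n by simp
    finally show ?thesis by (simp add: cyc_def)
  qed
  have cyc2: "cyc n (cyc n (k - 1) + 2) = cyc n (k + 1)" if "k \<ge> 1" for k
  proof -
    have "cyc n (k - 1) + 2 + (2 * n - 1) = (k - 1 + (2 * n - 1)) mod (2 * n) + (2 + 2 * n)"
      using n by (simp add: cyc_def)
    moreover have "(k + 1 + (2 * n - 1)) = (k - 1 + (2 * n - 1)) + 2" using that by simp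
    ultimately show ?thesis unfolding cyc_def
      by (metis mod_add_left_eq mod_add_self2 add.assoc)
  qed
  have cycid: "cyc n k = k" if "k \<in> {1..2*n}" for k
    using that n by (cases k) (auto simp: cyc_def)
  have Pc: "P (cyc n i) = P i" for i using P ev by auto
  have PS: "P (Suc k) \<longleftrightarrow> \<not> P k" "k \<ge> Suc 0 \<Longrightarrow> P (k - Suc 0) \<longleftrightarrow> \<not> P k" for k
    using P by auto
  let ?t = "\<lambda>k. {cyc n (k - 1), k, cyc n (k + 1)}"
  have tri: "?t k \<in> W'"
    if W: "unit_decomposition P n W S" "unit_decomposition P n W' S"
      and "?t k \<in> W" "k \<in> {1..2 * n}" "\<not> P k" for W W' k
  proof -
    have "k \<in> S" using W that by (auto simp: unit_decomposition_def)
    then obtain v where v: "v \<in> W'" "k \<in> v" using W(2) by (auto simp: unit_decomposition_def)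
    then have "pent_unit P n v" using W(2) by (auto simp: unit_decomposition_def)
    then have "v = ?t k"
      using v(2) \<open>\<not> P k\<close> unfolding pent_unit_def by (auto simp: Pc PS)
    with v show ?thesis by simp
  qed
  have "W \<subseteq> W'" if W: "unit_decomposition P n W S" "unit_decomposition P n W' S" for W W'
  proof
    fix u assume u: "u \<in> W"
    then have "pent_unit P n u" using W by (auto simp: unit_decomposition_def)
    then consider j where "j\<in>{1..2*n}" "P j" "u = {j}" | k where "k\<in>{1..2*n}" "\<not> P k" "u = ?t k"
      unfolding pent_unit_def by blast
    then show "u \<in> W'"
    proof cases
      case 2 then show ?thesis using tri[OF W] u by blast
    next
      case (1 j)
      then have "j \<in> S" using W u by (auto simp: unit_decomposition_def)
      then obtain v where v: "v \<in> W'" "j \<in> v" using W(2) by (auto simp: unit_decomposition_def)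
      then have "pent_unit P n v" using W(2) by (auto simp: unit_decomposition_def)
      then consider "v = {j}" | k where "k\<in>{1..2*n}" "\<not> P k" "v = ?t k"
        using v(2) unfolding pent_unit_def by blast
      then show ?thesis
      proof cases
        case single: 1 then show ?thesis using v 1 by simp
      next
        case (2 k)
        then have vW: "v \<in> W" using tri[OF W(2) W(1)] v by blast
        have "u \<noteq> v" using 1 2 by auto
        then have nc: "\<not> consecutive_units P n u v" using W(1) u vW by (auto simp: unit_decomposition_def)
        have "{i \<in> u \<union> v. P i} = {cyc n (k - 1), cyc n (k + 1)}"
          using 1 2 v(2) by (auto simp: Pc PS)
        also have "\<dots> = (\<lambda>t. cyc n (cyc n (k - 1) + 2 * t)) ` {..<2}"
        proof -
          have "{..<2} = {0, 1::nat}" by auto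
          moreover have "cyc n (k - 1) \<in> {1..2*n}"
            using n by (auto simp: cyc_def Suc_le_eq)
          ultimately show ?thesis using cyc2[of k] 2 cycid[of "cyc n (k - 1)"] by simp
        qed
        finally have "consecutive_units P n u v"
          unfolding consecutive_units_def using 2 n
          by (intro bexI[of _ "cyc n (k - 1)"] exI[of _ 2]) (auto simp: Pc PS, auto simp: cyc_def Suc_le_eq)
        with nc show ?thesis by blast
      qed
    qed
  qed
  then show ?thesis using U V by blast
qed

definition units_of_set :: "(nat \<Rightarrow> bool) \<Rightarrow> nat \<Rightarrow> nat set \<Rightarrow> nat set set" where
  "units_of_set P n S = (THE U. unit_decomposition P n U S)"

definition pent_weight :: "(nat \<Rightarrow> bool) \<Rightarrow> nat \<Rightarrow> nat set \<Rightarrow> nat" where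
  "pent_weight P n S = card (units_of_set P n S)"

definition pent_sign :: "(nat \<Rightarrow> bool) \<Rightarrow> nat \<Rightarrow> nat set \<Rightarrow> 'a::field" where
  "pent_sign P n S = (if even (card {u \<in> units_of_set P n S. card u = 1}) then 1 else - 1)"

text \<open>
  For \<open>n \<ge> 2\<close> the index \<open>n\<close> lies outside the range from \<open>1\<close> to \<open>n div 2\<close>, so the three cases do
  not clash.
\<close>

definition pent_invariant :: "(nat \<Rightarrow> bool) \<Rightarrow> nat \<Rightarrow> (nat \<Rightarrow> 'a::field) \<Rightarrow> nat \<Rightarrow> 'a" where
  "pent_invariant P n x k =
     (if k = 0 then 1
      else if k = n then \<Prod>i\<in>{i \<in> {1..2 * n}. P i}. x i
      else \<Sum>S\<in>{S. pent_admissible P n S \<and> pent_weight P n S = k}.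
             pent_sign P n S * (\<Prod>j\<in>S. x j))"

abbreviation pent_O :: "nat \<Rightarrow> (nat \<Rightarrow> 'a::field) \<Rightarrow> nat \<Rightarrow> 'a" where
  "pent_O \<equiv> pent_invariant odd"

abbreviation pent_E :: "nat \<Rightarrow> (nat \<Rightarrow> 'a::field) \<Rightarrow> nat \<Rightarrow> 'a" where
  "pent_E \<equiv> pent_invariant even"

end

(*
  Lift the vertices of A to vectors V k, scaled so that
    V (k + 3) = V (k + 2) - x V (k + 1) + x y x' V k;
  expanding the cross ratios in brackets shows that x = p_(2k+3), y = q_(2k+2), x' = p_(2k+1), and
  that the scaled lifts satisfy N (V k) = V (k + n) for some lift N of T. Solving the recurrence, the
  trace of N becomes the sum over all tilings of a cycle of length n by monomers (weight 1), dimers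
  (weight -x) and trimers (weight x' y x), and det N is the product of the trimer weights. A unit
  together with the gap that has to follow it is a dimer (singleton) or a trimer (triple), so the
  tilings are the admissible sets.
  The lines V k x V (k + 1), rescaled, satisfy the same recurrence with all indices shifted by one,
  which gives Omega_2.
*)
theory Submission
  imports Defs "HOL-Number_Theory.Cong"
begin

section \<open>Packings and tilings of a cycle\<close>

text \<open>Each lift is determined only up to a factor. Asking for the coefficient 1 at
  \<open>V (k + 2)\<close> leaves the first three factors free and fixes all later ones; this forces
  the monodromy to act on the lifts, from the third on, with one common multiplier, which can be
  absorbed into \<open>N\<close>. The trace becomes cyclic as follows. In the basis
  \<open>V (n - 2)\<close>, \<open>V (n - 1)\<close>, \<open>V n\<close> the coordinates of later
  vectors count tilings of a segment, because the three terms of the recurrence are the three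
  possible last tiles. A diagonal entry of \<open>N\<close> is one such coordinate, and the basis
  vector it belongs to records where the tile crossing the closing point of the cycle starts, or
  that there is none. The combinatorial obstacle is the cyclic meaning of being consecutive, where
  intervals may wrap around or fill the whole cycle. It is reduced to the overlap of tiles, after
  which admissible sets are packings. A parity shift \<open>s\<close> treats odd and even indices by
  one argument, so that the lines need no second count.\<close>

definition packing_sum :: "('b \<Rightarrow> 'c set) \<Rightarrow> ('b \<Rightarrow> 'a::comm_ring_1) \<Rightarrow> 'b set \<Rightarrow> 'a" where
  "packing_sum B w T = (\<Sum>U | U \<subseteq> T \<and> disjoint_family_on B U. prod w U)"

lemma packing_sum_empty [simp]: "packing_sum B w {} = 1"
proof -
  have "{U. U \<subseteq> {} \<and> disjoint_family_on B U} = {{}}"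
    by (auto simp: disjoint_family_on_def)
  then show ?thesis by (simp add: packing_sum_def)
qed

text \<open>Deletion and contraction at \<open>t\<close>: a family containing \<open>t\<close> is
  \<open>t\<close> together with a packing by tiles that avoid it.\<close>

lemma packing_sum_insert:
  assumes "finite T" "t \<notin> T"
  shows "packing_sum B w (insert t T) =
    packing_sum B w T + w t * packing_sum B w {s \<in> T. B s \<inter> B t = {}}"
proof -
  let ?D = "\<lambda>T. {U. U \<subseteq> T \<and> disjoint_family_on B U}"
  let ?T' = "{s \<in> T. B s \<inter> B t = {}}"
  have eq: "?D (insert t T) = ?D T \<union> insert t ` ?D ?T'"
  proof (intro set_eqI iffI)
    fix U assume U: "U \<in> ?D (insert t T)"
    show "U \<in> ?D T \<union> insert t ` ?D ?T'"
    proof (cases "t \<in> U")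
      case True
      then have "U = insert t (U - {t})" by blast
      moreover have "U - {t} \<in> ?D ?T'"
        using U True by (auto simp: disjoint_family_on_def)
      ultimately show ?thesis by blast
    qed (use U in auto)
  next
    fix U assume "U \<in> ?D T \<union> insert t ` ?D ?T'"
    then show "U \<in> ?D (insert t T)"
      by (auto simp: disjoint_family_on_def) blast+
  qed
  have fin: "finite (?D S)" if "finite S" for S
    using that by simp
  have "packing_sum B w (insert t T) = sum (prod w) (?D T) + sum (prod w) (insert t ` ?D ?T')"
    unfolding packing_sum_def eq
    by (rule sum.union_disjoint) (use assms fin in auto)
  also have "sum (prod w) (insert t ` ?D ?T') = (\<Sum>U\<in>?D ?T'. prod w (insert t U))"
    by (subst sum.reindex) (use assms in \<open>auto simp: inj_on_def intro: insert_ident[THEN iffD1]\<close>)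
  also have "\<dots> = (\<Sum>U\<in>?D ?T'. w t * prod w U)"
  proof (rule sum.cong[OF refl])
    fix U assume "U \<in> ?D ?T'"
    then have "t \<notin> U" "finite U" using assms finite_subset[of U T] by auto
    then show "prod w (insert t U) = w t * prod w U" by simp
  qed
  finally show ?thesis by (simp add: packing_sum_def sum_distrib_left)
qed

text \<open>The pair \<open>(l, t)\<close> is the tile of length \<open>l\<close> starting at position \<open>t\<close>. Only dimers and trimers
  are recorded, monomers fill the rest.\<close>

definition cells :: "nat \<Rightarrow> nat \<times> nat \<Rightarrow> nat set" where
  "cells n = (\<lambda>(l, t). (\<lambda>k. (t + k) mod n) ` {..<l})"

definition cyclic_tiles :: "nat \<Rightarrow> (nat \<times> nat) set" where
  "cyclic_tiles n = {2, 3} \<times> {..<n}"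

definition linear_tiles :: "nat \<Rightarrow> nat \<Rightarrow> (nat \<times> nat) set" where
  "linear_tiles i m = {(l, t). l \<in> {2, 3} \<and> i \<le> t \<and> t + l \<le> i + m}"

definition tile_weight :: "(nat \<Rightarrow> 'a) \<Rightarrow> (nat \<Rightarrow> 'a) \<Rightarrow> nat \<times> nat \<Rightarrow> 'a" where
  "tile_weight d e = (\<lambda>(l, t). if l = 2 then d t else e t)"

text \<open>The tilings of the \<open>m\<close> positions from \<open>i\<close> on, expanded along
  the last tile: monomer, dimer or trimer. Expanding at this end reproduces the recurrence of the
  lifts literally, with \<open>k = i + m\<close>.\<close>

fun tiling_sum :: "(nat \<Rightarrow> 'a::comm_ring_1) \<Rightarrow> (nat \<Rightarrow> 'a) \<Rightarrow> nat \<Rightarrow> nat \<Rightarrow> 'a" where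
  "tiling_sum d e i 0 = 1"
| "tiling_sum d e i (Suc 0) = 1"
| "tiling_sum d e i (Suc (Suc 0)) = 1 + d i"
| "tiling_sum d e i (Suc (Suc (Suc m))) = tiling_sum d e i (Suc (Suc m)) +
     d (Suc (i + m)) * tiling_sum d e i (Suc m) + e (i + m) * tiling_sum d e i m"

lemma cells_linear: "t + l \<le> n \<Longrightarrow> cells n (l, t) = {t..<t + l}"
proof -
  assume "t + l \<le> n"
  then have "cells n (l, t) = (\<lambda>k. t + k) ` {..<l}"
    unfolding cells_def by (auto intro!: image_cong)
  then show ?thesis by (simp add: lessThan_atLeast0 add.commute)
qed

lemma finite_linear_tiles [simp]: "finite (linear_tiles i m)"
  by (rule finite_subset[of _ "{..3} \<times> {..i + m}"]) (auto simp: linear_tiles_def)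

lemma linear_tiles_split: "linear_tiles i (Suc (Suc (Suc m))) =
    insert (3, i + m) (insert (2, Suc (i + m)) (linear_tiles i (Suc (Suc m))))"
  by (auto simp: linear_tiles_def)

lemma packing_sum_linear:
  "i + m \<le> n \<Longrightarrow> packing_sum (cells n) (tile_weight d e) (linear_tiles i m) = tiling_sum d e i m"
proof (induction d e i m rule: tiling_sum.induct)
  case (1 d e i)
  have "linear_tiles i 0 = {}" by (auto simp: linear_tiles_def)
  then show ?case by simp
next
  case (2 d e i)
  have "linear_tiles i (Suc 0) = {}" by (auto simp: linear_tiles_def)
  then show ?case by simp
next
  case (3 d e i)
  have "linear_tiles i (Suc (Suc 0)) = {(2, i)}" by (auto simp: linear_tiles_def)
  then show ?case by (simp add: packing_sum_insert tile_weight_def)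
next
  case (4 d e i m)
  let ?L = "linear_tiles i" and ?S = "packing_sum (cells n) (tile_weight d e)"
  have a: "{s \<in> ?L (Suc (Suc m)). cells n s \<inter> cells n (2, Suc (i + m)) = {}} = ?L (Suc m)"
    using 4(4) by (auto simp: linear_tiles_def cells_linear)
  have b: "{s \<in> insert (2, Suc (i + m)) (?L (Suc (Suc m))). cells n s \<inter> cells n (3, i + m) = {}} = ?L m"
    using 4(4) by (auto simp: linear_tiles_def cells_linear)
  have "?S (?L (Suc (Suc (Suc m)))) = ?S (insert (2, Suc (i + m)) (?L (Suc (Suc m)))) + e (i + m) * ?S (?L m)"
    unfolding linear_tiles_split
    by (subst packing_sum_insert, simp, force simp: linear_tiles_def, subst b) (simp add: tile_weight_def)
  also have "?S (insert (2, Suc (i + m)) (?L (Suc (Suc m)))) =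
      ?S (?L (Suc (Suc m))) + d (Suc (i + m)) * ?S (?L (Suc m))"
    by (subst packing_sum_insert, simp, force simp: linear_tiles_def, subst a) (simp add: tile_weight_def)
  finally show ?case using 4 by simp
qed

text \<open>The cycle is cut between \<open>n - 1\<close> and \<open>0\<close>. The tiles across the
  cut are the dimer at \<open>n - 1\<close> and the trimers at \<open>n - 1\<close> and
  \<open>n - 2\<close>; all contain \<open>0\<close>, so a packing uses at most one of them, and
  what remains is a segment.\<close>

lemma packing_sum_cyclic:
  assumes n: "n \<ge> 3"
  shows "packing_sum (cells n) (tile_weight d e) (cyclic_tiles n) =
    tiling_sum d e 0 n + d (n - 1) * tiling_sum d e 1 (n - 2) +
    e (n - 1) * tiling_sum d e 2 (n - 3) + e (n - 2) * tiling_sum d e 1 (n - 3)"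
proof -
  let ?L = "linear_tiles" and ?S = "packing_sum (cells n) (tile_weight d e)"
  define L1 where "L1 = insert (2, n - 1) (?L 0 n)"
  define L2 where "L2 = insert (3, n - 1) L1"
  have C: "cyclic_tiles n = insert (3, n - 2) L2"
    using n by (auto simp: cyclic_tiles_def linear_tiles_def L1_def L2_def)
  have lt: "{..<2} = {0, 1::nat}" "{..<3} = {0, 1, 2::nat}" by auto
  have c: "cells n (2, n - 1) = {n - 1, 0}" "cells n (3, n - 1) = {n - 1, 0, 1}"
    "cells n (3, n - 2) = {n - 2, n - 1, 0}"
  proof -
    have "n - 1 + 1 = n" "n - 1 + 2 = n + 1" "n - 2 + 2 = n" "n - 2 + 1 = n - 1" using n by auto
    moreover have "(n + 1) mod n = 1" using n by (metis add.commute mod_add_self1 mod_less One_nat_def Suc_le_eq numeral_3_eq_3 Suc_lessD)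
    ultimately show "cells n (2, n - 1) = {n - 1, 0}" "cells n (3, n - 1) = {n - 1, 0, 1}"
      "cells n (3, n - 2) = {n - 2, n - 1, 0}"
      using n by (auto simp: cells_def lt mod_simps)
  qed
  have l: "cells n s = {snd s..<snd s + fst s}" if "s \<in> ?L 0 n" for s
    using that cells_linear[of "snd s" "fst s" n] by (auto simp: linear_tiles_def)
  have a1: "{s \<in> ?L 0 n. cells n s \<inter> cells n (2, n - 1) = {}} = ?L 1 (n - 2)"
    unfolding c using n by (auto simp: l) (auto simp: linear_tiles_def cells_linear)
  have a2: "{s \<in> ?L 0 n. cells n s \<inter> cells n (3, n - 1) = {}} = ?L 2 (n - 3)"
    unfolding c using n by (auto simp: l) (auto simp: linear_tiles_def cells_linear)
  have a3: "{s \<in> ?L 0 n. cells n s \<inter> cells n (3, n - 2) = {}} = ?L 1 (n - 3)"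
    unfolding c using n by (auto simp: l) (auto simp: linear_tiles_def cells_linear)
  \<comment> \<open>Crossing tiles inserted earlier meet the new one, so only tiles inside the
    segment survive.\<close>
  have "{s \<in> L1. cells n s \<inter> cells n (3, n - 1) = {}} = ?L 2 (n - 3)"
    unfolding a2[symmetric] L1_def by (auto simp: c[unfolded One_nat_def])
  moreover have "{s \<in> L2. cells n s \<inter> cells n (3, n - 2) = {}} = ?L 1 (n - 3)"
    unfolding a3[symmetric] L1_def L2_def by (auto simp: c[unfolded One_nat_def])
  moreover have "finite L1" "finite L2" by (simp_all add: L1_def L2_def)
  moreover have "(3, n - 1) \<notin> L1" "(3, n - 2) \<notin> L2" "(2, n - 1) \<notin> ?L 0 n"
    using n by (auto simp: L1_def L2_def linear_tiles_def)
  ultimately have "?S (cyclic_tiles n) = ?S (?L 0 n) + d (n - 1) * ?S (?L 1 (n - 2)) +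
      e (n - 1) * ?S (?L 2 (n - 3)) + e (n - 2) * ?S (?L 1 (n - 3))"
    unfolding C by (simp add: packing_sum_insert tile_weight_def L2_def)
      (simp add: L1_def packing_sum_insert tile_weight_def a1[simplified])
  then show ?thesis using n by (simp add: packing_sum_linear)
qed

section \<open>Units as tiles\<close>

text \<open>Odd indices (\<open>s = 0\<close>) and even ones (\<open>s = 1\<close>) are treated together as the solutions of
  \<open>odd (i + s)\<close>, enumerated by \<open>pos s\<close> from \<open>t = 0\<close> on.\<close>

definition pos :: "nat \<Rightarrow> nat \<Rightarrow> nat" where
  "pos s t = 2 * t + 1 + s"

definition tile_unit :: "nat \<Rightarrow> nat \<Rightarrow> nat \<times> nat \<Rightarrow> nat set" where
  "tile_unit n s = (\<lambda>(l, t). if l = 2 then {pos s t}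
     else {pos s t, cyc n (pos s t + 1), pos s ((t + 1) mod n)})"

lemma pos_eq_iff [simp]: "pos s t = pos s t' \<longleftrightarrow> t = t'"
  by (simp add: pos_def)

lemma even_pos [simp]: "even (pos s t) \<longleftrightarrow> odd s"
  by (simp add: pos_def)

lemma cyc_pos: "n \<ge> 1 \<Longrightarrow> s < 2 \<Longrightarrow> cyc n (pos s r) = pos s (r mod n)"
proof -
  assume n: "n \<ge> 1" "s < 2"
  have "pos s r + (2 * n - 1) = (2 * r + s) + 2 * n" using n by (simp add: pos_def)
  moreover have "(2 * r + s) mod (2 * n) = 2 * (r mod n) + s"
    using n by (simp add: mod_mult2_eq)
  ultimately show ?thesis by (simp add: cyc_def pos_def)
qed

lemma cyc_id: "k \<in> {1..2 * n} \<Longrightarrow> cyc n k = k"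
  by (cases k) (auto simp: cyc_def)

lemma cyc_wrap: "n \<ge> 1 \<Longrightarrow> cyc n (2 * n + 1) = 1" "n \<ge> 1 \<Longrightarrow> cyc n 0 = 2 * n"
proof -
  assume "n \<ge> 1"
  then have "2 * n + 1 + (2 * n - 1) = 2 * n * 2" by simp
  then show "cyc n (2 * n + 1) = 1" unfolding cyc_def by simp
qed (simp add: cyc_def)

lemma pos_range: "t < n \<Longrightarrow> s < 2 \<Longrightarrow> pos s t \<in> {1..2 * n}"
  by (auto simp: pos_def)

lemma pos_surj:
  assumes "i \<in> {1..2 * n}" "odd (i + s)" "s < 2"
  obtains t where "t < n" "i = pos s t"
proof -
  have "\<exists>t. i + s = 2 * t + 1" using assms(2) by (blast elim: oddE)
  then obtain t where "i + s = 2 * t + 1" by blast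
  then have "i = pos s (t - s)" "t - s < n" using assms by (auto simp: pos_def)
  then show thesis using that by blast
qed

text \<open>The middle index leaves the range only for \<open>s = 1\<close> and
  \<open>t = n - 1\<close>, where it becomes \<open>1\<close>. In all other cases at most the third
  index wraps around.\<close>

lemma middle_pos:
  assumes t: "t < n" and s: "s < 2"
  defines "k \<equiv> cyc n (pos s t + 1)"
  shows "k \<in> {1..2 * n}" "even (k + s)" "cyc n (k - 1) = pos s t"
    "cyc n (k + 1) = pos s ((t + 1) mod n)"
proof -
  have "k \<in> {1..2 * n} \<and> even (k + s) \<and> cyc n (k - 1) = pos s t \<and>
    cyc n (k + 1) = pos s ((t + 1) mod n)"
  proof (cases "pos s t + 1 \<le> 2 * n")
    case True
    then have k: "k = pos s t + 1" unfolding k_def by (intro cyc_id) auto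
    moreover have "cyc n (k + 1) = cyc n (pos s (t + 1))" by (simp add: k pos_def)
    ultimately show ?thesis using True t s pos_range[of t n s]
      by (auto simp: cyc_pos cyc_id)
  next
    case False
    then have "s = 1" "t + 1 = n" using t s by (auto simp: pos_def)
    moreover from this have "pos s t = 2 * n" by (simp add: pos_def)
    moreover from this have "k = 1" using t cyc_wrap(1)[of n] by (simp add: k_def)
    ultimately show ?thesis using cyc_id[of 2 n] t cyc_wrap(2)[of n] by (auto simp: pos_def numeral_2_eq_2)
  qed
  then show "k \<in> {1..2 * n}" "even (k + s)" "cyc n (k - 1) = pos s t"
    "cyc n (k + 1) = pos s ((t + 1) mod n)" by blast+
qed

lemma middle_surj:
  assumes k: "k \<in> {1..2 * n}" "even (k + s)" "s < 2"
  obtains t where "t < n" "k = cyc n (pos s t + 1)"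
proof (cases "k = 1")
  case True
  then have "s = 1" using k by (cases s) auto
  moreover have "pos 1 (n - 1) = 2 * n" using k by (auto simp: pos_def)
  ultimately have "k = cyc n (pos s (n - 1) + 1)" "n - 1 < n"
    using True k cyc_wrap(1)[of n] by auto
  then show thesis using that by blast
next
  case False
  then have "k - 1 \<in> {1..2 * n}" "odd (k - 1 + s)" using k by auto
  then obtain t where "t < n" "k - 1 = pos s t" using pos_surj[of "k - 1"] k(3) by blast
  moreover from this have "pos s t + 1 = k" using False k by auto
  ultimately show thesis using that[of t] cyc_id[OF k(1)] by simp
qed

lemma pent_unit_iff:
  assumes "s < 2"
  shows "pent_unit (\<lambda>i. odd (i + s)) n u \<longleftrightarrow> u \<in> tile_unit n s ` cyclic_tiles n"
proof
  assume "pent_unit (\<lambda>i. odd (i + s)) n u"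
  then consider j where "j \<in> {1..2 * n}" "odd (j + s)" "u = {j}"
    | k where "k \<in> {1..2 * n}" "even (k + s)" "u = {cyc n (k - 1), k, cyc n (k + 1)}"
    unfolding pent_unit_def by blast
  then show "u \<in> tile_unit n s ` cyclic_tiles n"
  proof cases
    case 1
    then obtain t where "t < n" "j = pos s t" using pos_surj assms by blast
    then have "u = tile_unit n s (2, t)" "(2, t) \<in> cyclic_tiles n"
      using 1 by (auto simp: tile_unit_def cyclic_tiles_def)
    then show ?thesis by blast
  next
    case 2
    then obtain t where "t < n" "k = cyc n (pos s t + 1)" using middle_surj assms by blast
    then have "u = tile_unit n s (3, t)" "(3, t) \<in> cyclic_tiles n"
      using 2 middle_pos[of t n s] assms by (auto simp: tile_unit_def cyclic_tiles_def)
    then show ?thesis by blast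
  qed
next
  assume "u \<in> tile_unit n s ` cyclic_tiles n"
  then consider t where "t < n" "u = tile_unit n s (2, t)" | t where "t < n" "u = tile_unit n s (3, t)"
    by (auto simp: cyclic_tiles_def)
  then show "pent_unit (\<lambda>i. odd (i + s)) n u"
  proof cases
    case 1
    then show ?thesis using pos_range[of t n s] assms unfolding pent_unit_def tile_unit_def
      by (intro disjI1 bexI[of _ "pos s t"]) auto
  next
    case 2
    then show ?thesis using middle_pos[of t n s] assms unfolding pent_unit_def tile_unit_def
      by (intro disjI2 bexI[of _ "cyc n (pos s t + 1)"]) auto
  qed
qed

lemma middle_not_pos: "t < n \<Longrightarrow> s < 2 \<Longrightarrow> cyc n (Suc (pos s t)) \<noteq> pos s t'"
  using middle_pos(2)[of t n s] even_pos[of s t'] by (metis Suc_eq_plus1 even_add)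

lemma Suc_mod_neq: "(n::nat) \<ge> 2 \<Longrightarrow> t < n \<Longrightarrow> Suc t mod n \<noteq> t"
  by (cases "Suc t = n") auto

lemma card_tile_unit:
  assumes "n \<ge> 2" "s < 2" "(l, t) \<in> cyclic_tiles n"
  shows "card (tile_unit n s (l, t)) = (if l = 2 then 1 else 3)"
  using assms middle_not_pos[of t n s] Suc_mod_neq[of n t]
    middle_not_pos[of t n s, THEN not_sym] Suc_mod_neq[of n t, THEN not_sym]
  by (auto simp: tile_unit_def cyclic_tiles_def card_insert_if)

text \<open>The size of a unit gives \<open>l\<close>. For a triple, \<open>t\<close> is read off
  from the middle index, the only one of the other parity; the outer indices would not do, since for
  \<open>n = 2\<close> the two triples share them.\<close>

lemma inj_on_tile_unit:
  assumes n: "n \<ge> 2" and s: "s < 2"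
  shows "inj_on (tile_unit n s) (cyclic_tiles n)"
proof (rule inj_onI, clarify)
  fix l t l' t' assume a: "(l, t) \<in> cyclic_tiles n" "(l', t') \<in> cyclic_tiles n"
    "tile_unit n s (l, t) = tile_unit n s (l', t')"
  have "(if l = 2 then 1 else 3) = (if l' = 2 then 1 else 3 :: nat)"
    using card_tile_unit[OF n s a(1)] card_tile_unit[OF n s a(2)] a(3) by simp
  then have "l = l'" using a(1,2) by (auto simp: cyclic_tiles_def)
  moreover have "t = t'"
  proof (cases "l = 2")
    case True
    then show ?thesis using a \<open>l = l'\<close> by (simp add: tile_unit_def)
  next
    case False
    have t: "t < n" "t' < n" using a by (auto simp: cyclic_tiles_def)
    have "cyc n (pos s t + 1) \<in> tile_unit n s (l', t')"
      using a(3) False \<open>l = l'\<close> by (auto simp: tile_unit_def)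
    then have "cyc n (pos s t + 1) = cyc n (pos s t' + 1)"
      using False \<open>l = l'\<close> middle_not_pos[OF t(1) s] by (auto simp: tile_unit_def)
    then show ?thesis using middle_pos(3)[OF t(1) s] middle_pos(3)[OF t(2) s] by simp
  qed
  ultimately show "l = l' \<and> t = t'" by blast
qed

text \<open>Consecutiveness only sees the indices of the chosen parity. These fill all cells of the
  tile but the last, which is the gap; hence \<open>l - 1\<close>.\<close>

lemma parity_part_tile_unit:
  assumes "s < 2" "(l, t) \<in> cyclic_tiles n"
  shows "{i \<in> tile_unit n s (l, t). odd (i + s)} = pos s ` cells n (l - 1, t)"
proof -
  have lt: "{..<1} = {0::nat}" "{..<2} = {0, 1::nat}" by auto
  have t: "t < n" "l = 2 \<or> l = 3" using assms by (auto simp: cyclic_tiles_def)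
  show ?thesis
    using t(2) t(1) middle_pos(2)[OF t(1) assms(1)]
    by (elim disjE) (auto simp: tile_unit_def cells_def lt)
qed

section \<open>Consecutive units and overlapping tiles\<close>

lemma cells_shift: "cells n (a, (t + c) mod n) = (\<lambda>k. (t + k) mod n) ` {c..<c + a}"
proof -
  have "{c..<c + a} = (\<lambda>k. c + k) ` {..<a}" by (simp add: lessThan_atLeast0 add.commute)
  then show ?thesis unfolding cells_def by (simp add: image_image mod_simps add.assoc)
qed

text \<open>Since \<open>c \<le> l - 1\<close>, the second interval starts inside the first or
  directly after it, so no hole arises.\<close>

lemma cells_union:
  assumes "c < l"
  shows "cells n (l - 1, t) \<union> cells n (l' - 1, (t + c) mod n) = cells n (max (l - 1) (c + (l' - 1)), t)"
proof -
  have "{..<l - 1} \<union> {c..<c + (l' - 1)} = {..<max (l - 1) (c + (l' - 1))}"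
    using assms by auto
  then show ?thesis unfolding cells_shift by (simp add: cells_def flip: image_Un)
qed

text \<open>Enlarged by the gap that must follow it, a unit occupies \<open>l\<close> of the \<open>n\<close> positions; two
  intervals of length \<open>l - 1\<close> and \<open>l' - 1\<close> merge into one exactly if the enlarged ones meet, since
  otherwise their union has two distinct end points.\<close>

lemma cells_merge_iff:
  assumes n: "n \<ge> 3" and a: "(l, t) \<in> cyclic_tiles n" "(l', t') \<in> cyclic_tiles n"
  shows "(\<exists>r<n. \<exists>m. cells n (l - 1, t) \<union> cells n (l' - 1, t') = cells n (m, r)) \<longleftrightarrow>
    cells n (l, t) \<inter> cells n (l', t') \<noteq> {}"
proof
  have t: "t < n" "t' < n" and l: "2 \<le> l" "l \<le> n" "2 \<le> l'" "l' \<le> n"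
    using a n by (auto simp: cyclic_tiles_def)
  {
    assume "\<exists>r<n. \<exists>m. cells n (l - 1, t) \<union> cells n (l' - 1, t') = cells n (m, r)"
    then obtain r m where U: "cells n (l - 1, t) \<union> cells n (l' - 1, t') = cells n (m, r)" by blast
    show "cells n (l, t) \<inter> cells n (l', t') \<noteq> {}"
    proof
      assume disj: "cells n (l, t) \<inter> cells n (l', t') = {}"
      \<comment> \<open>The bound \<open>l \<le> n\<close> keeps the gap cell from wrapping around
        onto the interval itself.\<close>
      have last_notin: "(t + (l - 1)) mod n \<notin> cells n (l - 1, t)" if "l \<le> n" for l t
      proof
        assume "(t + (l - 1)) mod n \<in> cells n (l - 1, t)"
        then obtain k where k: "k < l - 1" "[t + (l - 1) = t + k] (mod n)"
          by (auto simp: cells_def cong_def)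
        then have "[l - 1 = k] (mod n)" using cong_add_lcancel_nat by blast
        then show False using k that by (simp add: cong_def)
      qed
      have sub: "cells n (l - 1, t) \<subseteq> cells n (l, t)" for l t
        by (auto simp: cells_def)
      \<comment> \<open>The cell before the gap lies on the arc and the gap cell does not, so the
        gap cell is the first one after the arc. This holds for both tiles, whose gap cells
        therefore coincide, contradicting disjointness.\<close>
      have end_eq: "(t + (l - 1)) mod n = (r + m) mod n"
        if l2: "2 \<le> l" and sub': "cells n (l - 1, t) \<subseteq> cells n (m, r)"
          and notin: "(t + (l - 1)) mod n \<notin> cells n (m, r)" for l t
      proof -
        have "(t + (l - 2)) mod n \<in> cells n (l - 1, t)" unfolding cells_def
          using l2 by (simp del: add_diff_assoc add_diff_assoc2)
        then obtain k where k: "k < m" "(t + (l - 2)) mod n = (r + k) mod n"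
          using sub' by (auto simp: cells_def)
        have "t + (l - 1) = (t + (l - 2)) + 1" using l2 by simp
        then have "(t + (l - 1)) mod n = ((t + (l - 2)) + 1) mod n" by (rule arg_cong)
        also have "\<dots> = ((r + k) mod n + 1) mod n" unfolding k(2)[symmetric] by (rule mod_add_left_eq[symmetric])
        also have "\<dots> = (r + Suc k) mod n" by (simp add: mod_simps)
        finally have e: "(t + (l - 1)) mod n = (r + Suc k) mod n" .
        have "\<not> Suc k < m"
          using notin unfolding e by (auto simp: cells_def simp del: add_Suc_right)
        then show ?thesis using k(1) e by (metis Suc_lessI)
      qed
      have in': "(t + (l - 1)) mod n \<in> cells n (l, t)" if "2 \<le> l" for l t
        unfolding cells_def using that by (simp del: add_diff_assoc add_diff_assoc2)
      have "cells n (l - 1, t) \<subseteq> cells n (m, r)" "cells n (l' - 1, t') \<subseteq> cells n (m, r)"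
        unfolding U[symmetric] by blast+
      moreover have "(t + (l - 1)) mod n \<notin> cells n (m, r)"
        unfolding U[symmetric] using last_notin[OF l(2)] in'[OF l(1)] sub disj by blast
      moreover have "(t' + (l' - 1)) mod n \<notin> cells n (m, r)"
        unfolding U[symmetric] using last_notin[OF l(4)] in'[OF l(3)] sub disj by blast
      ultimately have "(t + (l - 1)) mod n = (t' + (l' - 1)) mod n"
        using end_eq[OF l(1)] end_eq[OF l(3)] by metis
      then show False using in'[OF l(1), of t] in'[OF l(3), of t'] disj by (metis disjoint_iff)
    qed
  next
    \<comment> \<open>A common cell at offset \<open>k\<close> in the first tile and
      \<open>k' \<le> k\<close> in the second makes the second tile start at offset
      \<open>k - k'\<close> of the first.\<close>
    have merge: "\<exists>r<n. \<exists>m. cells n (l - 1, t) \<union> cells n (l' - 1, t') = cells n (m, r)"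
      if "t < n" "t' < n" "k < l" "k' \<le> k" "(t + k) mod n = (t' + k') mod n" for l t l' t' k k'
    proof -
      have "[t' + k' = (t + (k - k')) + k'] (mod n)" using that by (simp add: cong_def)
      then have "[t' = t + (k - k')] (mod n)" using cong_add_rcancel_nat by blast
      then have "t' = (t + (k - k')) mod n" using \<open>t' < n\<close> by (simp add: cong_def)
      moreover have "k - k' < l" using that by simp
      ultimately show ?thesis using cells_union[of "k - k'" l n t l'] \<open>t < n\<close> by metis
    qed
    assume "cells n (l, t) \<inter> cells n (l', t') \<noteq> {}"
    then obtain k k' where k: "k < l" "k' < l'" "(t + k) mod n = (t' + k') mod n"
      by (auto simp: cells_def)
    show "\<exists>r<n. \<exists>m. cells n (l - 1, t) \<union> cells n (l' - 1, t') = cells n (m, r)"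
    proof (cases "k' \<le> k")
      case True
      then show ?thesis using merge t k by blast
    next
      case False
      then have "\<exists>r<n. \<exists>m. cells n (l' - 1, t') \<union> cells n (l - 1, t) = cells n (m, r)"
        using merge[OF t(2) t(1) k(2), of k] k by simp
      then show ?thesis by (simp add: Un_commute)
    qed
  }
qed

lemma consecutive_units_iff:
  assumes n: "n \<ge> 3" and s: "s < 2" and a: "a \<in> cyclic_tiles n" "b \<in> cyclic_tiles n"
  shows "consecutive_units (\<lambda>i. odd (i + s)) n (tile_unit n s a) (tile_unit n s b) \<longleftrightarrow>
    cells n a \<inter> cells n b \<noteq> {}"
proof -
  obtain l t l' t' where ab: "a = (l, t)" "b = (l', t')" by (metis prod.exhaust)
  let ?U = "cells n (l - 1, t) \<union> cells n (l' - 1, t')"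
  have "{i \<in> tile_unit n s a \<union> tile_unit n s b. odd (i + s)} =
      {i \<in> tile_unit n s a. odd (i + s)} \<union> {i \<in> tile_unit n s b. odd (i + s)}" by blast
  also have "\<dots> = pos s ` ?U"
    using parity_part_tile_unit[OF s] a unfolding ab by (simp add: image_Un)
  finally have U: "{i \<in> tile_unit n s a \<union> tile_unit n s b. odd (i + s)} = pos s ` ?U" .
  have arc: "(\<lambda>t. cyc n (pos s r + 2 * t)) ` {..<m} = pos s ` cells n (m, r)" for r m
  proof -
    have "cyc n (pos s r + 2 * t) = pos s ((r + t) mod n)" for t
      using cyc_pos[of n s "r + t"] n s by (simp add: pos_def algebra_simps)
    then show ?thesis by (simp add: cells_def image_image)
  qed
  have inj: "inj (pos s)" by (simp add: inj_def)
  have "consecutive_units (\<lambda>i. odd (i + s)) n (tile_unit n s a) (tile_unit n s b) \<longleftrightarrow>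
      (\<exists>r<n. \<exists>m. pos s ` ?U = (\<lambda>t. cyc n (pos s r + 2 * t)) ` {..<m})"
    unfolding consecutive_units_def U
    using pos_surj[OF _ _ s] pos_range[OF _ s] by (metis even_add even_pos)
  also have "\<dots> \<longleftrightarrow> (\<exists>r<n. \<exists>m. ?U = cells n (m, r))"
    unfolding arc by (simp only: inj_image_eq_iff[OF inj])
  also have "\<dots> \<longleftrightarrow> cells n a \<inter> cells n b \<noteq> {}"
    unfolding ab by (rule cells_merge_iff[OF n]) (use a ab in auto)
  finally show ?thesis .
qed

section \<open>From packings to pentagram invariants\<close>

lemma half_card_packing:
  assumes n: "n \<ge> 3" and V: "V \<subseteq> cyclic_tiles n" "disjoint_family_on (cells n) V"
  shows "card V \<le> n div 2"
proof -
  have fV: "finite V" using V(1) by (rule finite_subset) (simp add: cyclic_tiles_def)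
  have "cells n a \<subseteq> {..<n} \<and> 2 \<le> card (cells n a)" if aV: "a \<in> V" for a
  proof -
    obtain l t where lt: "a = (l, t)" "l \<in> {2, 3}" "t < n"
      using V(1) aV by (auto simp: cyclic_tiles_def)
    have "{t, Suc t mod n} \<subseteq> cells n a" using lt
      by (auto simp: cells_def image_iff intro: bexI[of _ 0] bexI[of _ 1])
    moreover have fin: "cells n a \<subseteq> {..<n}" using n by (auto simp: lt cells_def)
    moreover have "card {t, Suc t mod n} = 2" using Suc_mod_neq[of n t] n lt by simp
    ultimately show ?thesis by (metis card_mono finite_lessThan finite_subset)
  qed
  then have "card V * 2 \<le> (\<Sum>a\<in>V. card (cells n a))"
    using sum_bounded_below[of V 2 "\<lambda>a. card (cells n a)"] by simp
  also have "\<dots> = card (\<Union>a\<in>V. cells n a)"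
    by (rule card_UN_disjoint[symmetric])
      (use fV V(2) in \<open>auto simp: disjoint_family_on_def cells_def\<close>)
  also have "\<dots> \<le> card {..<n}"
    by (rule card_mono) (use n in \<open>auto simp: cells_def\<close>)
  finally show ?thesis by simp
qed

text \<open>Injectivity of \<open>tile_unit\<close> turns the condition on distinct units into one
  on distinct tiles, which is pairwise disjointness of their cells.\<close>

lemma unit_decomposition_iff:
  assumes n: "n \<ge> 3" and s: "s < 2"
  shows "unit_decomposition (\<lambda>i. odd (i + s)) n U S \<longleftrightarrow>
    (\<exists>V. V \<noteq> {} \<and> V \<subseteq> cyclic_tiles n \<and> disjoint_family_on (cells n) V \<and>
      U = tile_unit n s ` V \<and> S = \<Union>U)"
proof -
  have inj: "inj_on (tile_unit n s) (cyclic_tiles n)" using inj_on_tile_unit n s by simp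
  have "(\<forall>u\<in>tile_unit n s ` V. \<forall>v\<in>tile_unit n s ` V. u \<noteq> v \<longrightarrow>
      \<not> consecutive_units (\<lambda>i. odd (i + s)) n u v) \<longleftrightarrow> disjoint_family_on (cells n) V"
    if "V \<subseteq> cyclic_tiles n" for V
    unfolding disjoint_family_on_def ball_simps
    using that inj by (intro ball_cong refl) (metis consecutive_units_iff[OF n s] inj_on_eq_iff subsetD)
  moreover have "(\<forall>u\<in>U. pent_unit (\<lambda>i. odd (i + s)) n u) \<longleftrightarrow>
      (\<exists>V. V \<subseteq> cyclic_tiles n \<and> U = tile_unit n s ` V)"
    unfolding pent_unit_iff[OF s] subset_image_iff[symmetric] by blast
  ultimately show ?thesis unfolding unit_decomposition_def by (smt (verit) image_is_empty)
qed

lemma unit_signed_prod: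
  assumes n: "n \<ge> 3" and s: "s < 2" and a: "a \<in> cyclic_tiles n"
  shows "(if card (tile_unit n s a) = 1 then - 1 else 1) * prod x (tile_unit n s a) =
    tile_weight (\<lambda>t. - x (pos s t))
      (\<lambda>t. x (pos s t) * x (cyc n (pos s t + 1)) * x (pos s ((t + 1) mod n)) :: 'a::field) a"
proof -
  obtain l t where lt: "a = (l, t)" "l \<in> {2, 3}" "t < n" using a by (auto simp: cyclic_tiles_def)
  show ?thesis
    using card_tile_unit[of n s l t] a n s lt middle_not_pos[of t n s] Suc_mod_neq[of n t]
    middle_not_pos[of t n s, THEN not_sym] Suc_mod_neq[of n t, THEN not_sym]
    by (auto simp: tile_unit_def tile_weight_def mult.assoc)
qed

text \<open>Admissible sets of weight \<open>k\<close> correspond to packings with \<open>k\<close>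
  tiles, by uniqueness of the decomposition into units. The empty set is not admissible; the empty
  packing is accounted for by the separate value 1 at \<open>k = 0\<close>.\<close>

lemma sum_pent_invariant:
  fixes x :: "nat \<Rightarrow> 'a::field"
  assumes n: "n \<ge> 3" and s: "s < 2"
  shows "(\<Sum>k=0..n div 2. pent_invariant (\<lambda>i. odd (i + s)) n x k) =
    packing_sum (cells n) (tile_weight (\<lambda>t. - x (pos s t))
      (\<lambda>t. x (pos s t) * x (cyc n (pos s t + 1)) * x (pos s ((t + 1) mod n)))) (cyclic_tiles n)"
    (is "_ = packing_sum _ ?w _")
proof -
  let ?P = "\<lambda>i. odd (i + s)"
  define D where "D = {V. V \<subseteq> cyclic_tiles n \<and> disjoint_family_on (cells n) V}"
  have inj: "inj_on (tile_unit n s) (cyclic_tiles n)" using inj_on_tile_unit n s by simp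
  have P: "?P = odd \<or> ?P = even" using s by (cases s) auto
  have fin: "finite (cyclic_tiles n)" by (simp add: cyclic_tiles_def)
  have finD: "finite D" unfolding D_def using fin by simp
  have finV: "finite V" if "V \<in> D" for V using that fin finite_subset by (auto simp: D_def)
  define S where "S V = \<Union> (tile_unit n s ` V)" for V
  have dec: "unit_decomposition ?P n (tile_unit n s ` V) (S V)" if "V \<in> D" "V \<noteq> {}" for V
    using that unit_decomposition_iff[OF n s] by (auto simp: D_def S_def)
  have units: "units_of_set ?P n (S V) = tile_unit n s ` V" if "V \<in> D" "V \<noteq> {}" for V
    unfolding units_of_set_def
  proof (rule the_equality)
    show "unit_decomposition ?P n (tile_unit n s ` V) (S V)" by (rule dec[OF that])
    fix U assume "unit_decomposition ?P n U (S V)"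
    then show "U = tile_unit n s ` V" using unit_decomposition_unique[OF P _ _ dec[OF that]] n by force
  qed
  have card_image: "card (tile_unit n s ` V) = card V" if "V \<in> D" for V
    by (rule Finite_Set.card_image[OF inj_on_subset[OF inj]]) (use that in \<open>auto simp: D_def\<close>)
  have injS: "inj_on S {V \<in> D. V \<noteq> {}}"
  proof (rule inj_onI)
    fix V W assume "V \<in> {V \<in> D. V \<noteq> {}}" "W \<in> {V \<in> D. V \<noteq> {}}" "S V = S W"
    then have "tile_unit n s ` V = tile_unit n s ` W" using units[of V] units[of W] by simp
    moreover have "V \<subseteq> cyclic_tiles n" "W \<subseteq> cyclic_tiles n"
      using \<open>V \<in> _\<close> \<open>W \<in> _\<close> by (auto simp: D_def)
    ultimately show "V = W" using inj_on_image_eq_iff[OF inj] by simp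
  qed
  have admissible: "{T. pent_admissible ?P n T \<and> pent_weight ?P n T = k} = S ` {V \<in> D. V \<noteq> {} \<and> card V = k}" for k
  proof -
    have "pent_admissible ?P n T \<longleftrightarrow> T \<in> S ` {V \<in> D. V \<noteq> {}}" for T
      unfolding pent_admissible_def unit_decomposition_iff[OF n s] by (auto simp: D_def S_def)
    then have "{T. pent_admissible ?P n T \<and> pent_weight ?P n T = k} =
        {T \<in> S ` {V \<in> D. V \<noteq> {}}. pent_weight ?P n T = k}" by (simp only:)
    also have "\<dots> = S ` {V \<in> {V \<in> D. V \<noteq> {}}. pent_weight ?P n (S V) = k}" by blast
    also have "{V \<in> {V \<in> D. V \<noteq> {}}. pent_weight ?P n (S V) = k} = {V \<in> D. V \<noteq> {} \<and> card V = k}"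
    proof -
      have "pent_weight ?P n (S V) = card V" if "V \<in> D" "V \<noteq> {}" for V
        unfolding pent_weight_def units[OF that] card_image[OF that(1)] ..
      then show ?thesis by (intro Collect_cong) (simp cong: conj_cong)
    qed
    finally show ?thesis .
  qed
  have summand: "pent_sign ?P n (S V) * prod x (S V) = prod ?w V" if V: "V \<in> D" "V \<noteq> {}" for V
  proof -
    have sub: "V \<subseteq> cyclic_tiles n" using V by (simp add: D_def)
    then have injV: "inj_on (tile_unit n s) V" using inj inj_on_subset by blast
    \<comment> \<open>The product over the union factors only if the units are disjoint as index
      sets. A shared index of the chosen parity gives a shared cell; a shared middle index gives the
      same starting cell.\<close>
    have "tile_unit n s a \<inter> tile_unit n s b = {}" if ab: "a \<in> V" "b \<in> V" "a \<noteq> b" for a b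
    proof (rule ccontr)
      have abc: "a \<in> cyclic_tiles n" "b \<in> cyclic_tiles n" using ab sub by auto
      obtain l t l' t' where lt: "a = (l, t)" "b = (l', t')" "t < n" "t' < n" "l \<in> {2, 3}" "l' \<in> {2, 3}"
        using abc by (auto simp: cyclic_tiles_def)
      have sub1: "cells n (l - 1, t) \<subseteq> cells n (l, t)" for l t by (auto simp: cells_def)
      assume "tile_unit n s a \<inter> tile_unit n s b \<noteq> {}"
      then obtain i where i: "i \<in> tile_unit n s a" "i \<in> tile_unit n s b" by blast
      have "cells n (l - 1, t) \<inter> cells n (l' - 1, t') \<noteq> {}"
      proof (cases "odd (i + s)")
        case True
        then have "i \<in> pos s ` cells n (l - 1, t) \<inter> pos s ` cells n (l' - 1, t')"
          using i parity_part_tile_unit[OF s] abc unfolding lt by blast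
        then show ?thesis by auto
      next
        case False
        then have "i \<noteq> pos s r" for r by auto
        then have "i = cyc n (pos s t + 1)" "i = cyc n (pos s t' + 1)"
          using i unfolding lt by (auto simp: tile_unit_def split: if_splits)
        then have "t = t'" using middle_pos(3)[OF lt(3) s] middle_pos(3)[OF lt(4) s] by simp
        moreover have "t \<in> cells n (l - 1, t)" if "l \<in> {2, 3}" "t < n" for l t
          using that by (auto simp: cells_def image_iff intro!: bexI[of _ 0])
        ultimately show ?thesis using lt by blast
      qed
      then have "cells n a \<inter> cells n b \<noteq> {}" using sub1 unfolding lt by blast
      then show False using V(1) ab by (auto simp: D_def disjoint_family_on_def)
    qed
    then have "prod x (S V) = (\<Prod>a\<in>V. prod x (tile_unit n s a))"
      unfolding S_def by (intro prod.UNION_disjoint) (use finV[OF V(1)] in \<open>auto simp: tile_unit_def\<close>)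
    \<comment> \<open>The parity of the number of singletons is spread over the tiles, one factor -1
      for each dimer.\<close>
    moreover have "pent_sign ?P n (S V) = (\<Prod>a\<in>V. if card (tile_unit n s a) = 1 then - 1 else 1 :: 'a)"
    proof -
      have "{u \<in> tile_unit n s ` V. card u = 1} = tile_unit n s ` {a \<in> V. card (tile_unit n s a) = 1}" by auto
      then have "card {u \<in> tile_unit n s ` V. card u = 1} = card {a \<in> V. card (tile_unit n s a) = 1}"
        by (simp only:) (rule Finite_Set.card_image[OF inj_on_subset[OF injV]], blast)
      moreover have "(\<Prod>a\<in>V. if card (tile_unit n s a) = 1 then - 1 else 1 :: 'a) =
          (\<Prod>a\<in>{a \<in> V. card (tile_unit n s a) = 1}. - 1)"
        by (rule prod.inter_filter[symmetric, OF finV[OF V(1)]])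
      ultimately show ?thesis unfolding pent_sign_def units[OF V] by (simp add: uminus_power_if)
    qed
    ultimately have "pent_sign ?P n (S V) * prod x (S V) =
        (\<Prod>a\<in>V. (if card (tile_unit n s a) = 1 then - 1 else 1) * prod x (tile_unit n s a))"
      by (simp add: prod.distrib)
    also have "\<dots> = prod ?w V"
      by (rule prod.cong[OF refl]) (use unit_signed_prod[OF n s] sub in blast)
    finally show ?thesis .
  qed
  have "pent_invariant ?P n x k = sum (prod ?w) {V \<in> D. card V = k}" if k: "k \<in> {0..n div 2}" for k
  proof (cases "k = 0")
    case True
    have "{V \<in> D. card V = k} = {{}}" using finV True by (auto simp: D_def disjoint_family_on_def)
    then show ?thesis using True by (simp add: pent_invariant_def)
  next
    case False
    then have ne: "{V \<in> D. card V = k} = {V \<in> D. V \<noteq> {} \<and> card V = k}" by auto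
    \<comment> \<open>This avoids the branch of \<open>pent_invariant\<close> that holds the full
      product.\<close>
    have "k \<noteq> n" using k n by auto
    then have "pent_invariant ?P n x k =
        (\<Sum>T\<in>S ` {V \<in> D. V \<noteq> {} \<and> card V = k}. pent_sign ?P n T * prod x T)"
      using False unfolding pent_invariant_def admissible by simp
    also have "\<dots> = (\<Sum>V\<in>{V \<in> D. V \<noteq> {} \<and> card V = k}. pent_sign ?P n (S V) * prod x (S V))"
      by (rule sum.reindex_cong[OF _ refl refl]) (rule inj_on_subset[OF injS], auto)
    also have "\<dots> = sum (prod ?w) {V \<in> D. card V = k}"
      unfolding ne by (rule sum.cong[OF refl]) (use summand in auto)
    finally show ?thesis .
  qed
  then have "(\<Sum>k=0..n div 2. pent_invariant ?P n x k) = (\<Sum>k=0..n div 2. sum (prod ?w) {V \<in> D. card V = k})"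
    by (intro sum.cong) auto
  \<comment> \<open>Every tile covers at least two of the \<open>n\<close> cells, so the cutoff at
    \<open>n div 2\<close> loses no packing.\<close>
  also have "\<dots> = sum (prod ?w) D"
    by (rule sum.group) (use finD half_card_packing[OF n] in \<open>auto simp: D_def\<close>)
  finally show ?thesis by (simp add: packing_sum_def D_def)
qed

section \<open>Linear recurrences of order three\<close>

text \<open>The determinant of the three vectors, expanded so that identities between brackets
  become polynomial ones.\<close>

definition bracket :: "'a::field ^ 3 \<Rightarrow> 'a ^ 3 \<Rightarrow> 'a ^ 3 \<Rightarrow> 'a" where
  "bracket u v w = u $ 1 * (v $ 2 * w $ 3 - v $ 3 * w $ 2) - u $ 2 * (v $ 1 * w $ 3 - v $ 3 * w $ 1)
     + u $ 3 * (v $ 1 * w $ 2 - v $ 2 * w $ 1)"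

lemma bracket_add [simp]:
  "bracket (u + u') v w = bracket u v w + bracket u' v w"
  "bracket u (v + v') w = bracket u v w + bracket u v' w"
  "bracket u v (w + w') = bracket u v w + bracket u v w'"
  by (simp_all add: bracket_def algebra_simps)

lemma bracket_diff [simp]:
  "bracket (u - u') v w = bracket u v w - bracket u' v w"
  "bracket u (v - v') w = bracket u v w - bracket u v' w"
  "bracket u v (w - w') = bracket u v w - bracket u v w'"
  by (simp_all add: bracket_def algebra_simps)

lemma bracket_scale [simp]:
  "bracket (c *s u) v w = c * bracket u v w"
  "bracket u (c *s v) w = c * bracket u v w"
  "bracket u v (c *s w) = c * bracket u v w"
  by (simp_all add: bracket_def algebra_simps)

lemma bracket_same [simp]: "bracket u u w = 0" "bracket u v u = 0" "bracket u v v = 0"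
  by (simp_all add: bracket_def algebra_simps)

lemma bracket_rotate: "bracket v w u = bracket u v w"
  by (simp add: bracket_def algebra_simps)

lemma bracket_swap: "bracket v u w = - bracket u v w" "bracket u w v = - bracket u v w"
  by (simp_all add: bracket_def algebra_simps)

lemma matrix_vector_mult_3:
  fixes N :: "'a::field ^ 3 ^ 3"
  shows "(N *v u) $ i = N $ i $ 1 * u $ 1 + N $ i $ 2 * u $ 2 + N $ i $ 3 * u $ 3"
  by (simp add: matrix_vector_mult_def sum_3)

text \<open>The linearization of \<open>det_bracket\<close> at the identity. It gives the trace from
  any three independent vectors, without a change of basis.\<close>

lemma trace_bracket:
  "bracket (N *v u) v w + bracket u (N *v v) w + bracket u v (N *v w) = trace N * bracket u v w"
  unfolding bracket_def matrix_vector_mult_3 trace_def sum_3 by algebra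

lemma det_bracket: "bracket (N *v u) (N *v v) (N *v w) = det N * bracket u v w"
  unfolding bracket_def matrix_vector_mult_3 det_3 by algebra

lemma tiling_sum_shift:
  assumes "\<And>k. d (k + n) = d k" "\<And>k. e (k + n) = e k"
  shows "tiling_sum d e (n + i) m = tiling_sum d e i m"
proof -
  have "d (n + k) = d k" "e (n + k) = e k" for k using assms[of k] by (simp_all add: add.commute)
  then show ?thesis
    by (induction d e i m rule: tiling_sum.induct) (simp_all add: add.assoc flip: add_Suc_right)
qed

text \<open>Brackets are linear in each argument, so a coordinate of the lifts satisfies their
  recurrence; comparing three initial values then identifies it. The factor \<open>c\<close> is the
  weight of a tile already placed, up to normalization.\<close>

lemma tiling_sum_unique:
  fixes u :: "nat \<Rightarrow> 'a::comm_ring_1"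
  assumes "u 0 = c" "u (Suc 0) = c" "u (Suc (Suc 0)) = c * (1 + d i)"
    and "\<And>m. u (Suc (Suc (Suc m))) =
      u (Suc (Suc m)) + d (Suc (i + m)) * u (Suc m) + e (i + m) * u m"
  shows "u m = c * tiling_sum d e i m"
proof (induction m rule: less_induct)
  case (less m)
  consider "m = 0" | "m = Suc 0" | "m = Suc (Suc 0)" | j where "m = Suc (Suc (Suc j))"
    by (metis not0_implies_Suc)
  then show ?case
    by cases (use assms less in \<open>simp_all add: algebra_simps\<close>)
qed

text \<open>With the basis \<open>U0\<close>, \<open>U1\<close>, \<open>U2\<close>, the trace is the
  sum of one coordinate each of \<open>V (2 * n - 2)\<close>, \<open>V (2 * n - 1)\<close>,
  \<open>V (2 * n)\<close>. The last counts the tilings that respect the cut, the second those with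
  a crossing tile that starts at \<open>n - 1\<close>, the first those with the trimer at
  \<open>n - 2\<close>.\<close>

lemma
  fixes V :: "nat \<Rightarrow> 'a::field ^ 3"
  assumes n: "n \<ge> 3"
    and V: "\<And>k. V (k + 3) = V (k + 2) + d (k + 1) *s V (k + 1) + e k *s V k"
    and d: "\<And>k. d (k + n) = d k" and e: "\<And>k. e (k + n) = e k"
    and N: "\<And>k. N *v V k = V (k + n)"
    and ind: "\<And>k. bracket (V k) (V (k + 1)) (V (k + 2)) \<noteq> 0"
  shows trace_recurrence:
      "trace N = packing_sum (cells n) (tile_weight d e) (cyclic_tiles n)"
    and det_recurrence: "det N = (\<Prod>t<n. e t)"
proof -
  let ?K = "tiling_sum d e"
  obtain p where p: "n = Suc (Suc (Suc p))"
    using n by (metis Suc_le_D numeral_3_eq_3 Suc_le_mono)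
  define U0 U1 U2 where "U0 = V (Suc p)" and "U1 = V (Suc (Suc p))" and "U2 = V n"
  define D where "D = bracket U0 U1 U2"
  define d' where "d' = d (Suc (Suc p))"
  define e1 where "e1 = e (Suc p)"
  define e2 where "e2 = e (Suc (Suc p))"
  have D: "D \<noteq> 0" using ind[of "Suc p"] by (simp add: D_def U0_def U1_def U2_def p)
  have VS: "V (Suc (Suc (Suc k))) = V (Suc (Suc k)) + d (Suc k) *s V (Suc k) + e k *s V k" for k
    using V[of k] by (simp add: numeral_2_eq_2 numeral_3_eq_3)
  have V0: "V n = U2" by (simp add: U2_def)
  have V1: "V (Suc n) = U2 + d' *s U1 + e1 *s U0"
    using VS[of "Suc p"] by (simp add: U0_def U1_def U2_def p d'_def e1_def)
  have V2: "V (Suc (Suc n)) = V (Suc n) + d n *s U2 + e2 *s U1"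
    using VS[of "Suc (Suc p)"] by (simp add: U1_def U2_def p e2_def)
  have f: "bracket U0 U1 (V (n + m)) = D * ?K n m" for m
    by (rule tiling_sum_unique) (simp_all add: V0 V1 V2 VS D_def algebra_simps)
  have h: "bracket (V (Suc (n + m))) U1 U2 = (e1 * D) * ?K (Suc n) m" for m
    by (rule tiling_sum_unique) (simp_all add: V0 V1 V2 VS D_def algebra_simps)
  \<comment> \<open>The coordinate along \<open>U1\<close> begins with \<open>d'\<close>,
    \<open>d' + e2\<close>: it superposes the contributions of the crossing dimer and the crossing
    trimer, which leave segments starting one position apart. Removing the first leaves a multiple
    of a single tiling sum.\<close>
  have g: "bracket U0 (V (Suc (Suc (n + m)))) U2 - d' * D * ?K (Suc n) (Suc m) =
      (e2 * D) * ?K (Suc (Suc n)) m" for m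
    by (rule tiling_sum_unique)
      (simp_all add: V0 V1 V2 VS D_def algebra_simps)
  have shift: "?K (n + i) m = ?K i m" for i m by (rule tiling_sum_shift) (rule d, rule e)
  have "trace N * D = bracket (V (Suc (n + p))) U1 U2 + bracket U0 (V (Suc (Suc (n + p)))) U2 + bracket U0 U1 (V (n + n))"
    unfolding trace_bracket[symmetric] D_def by (simp add: U0_def U1_def U2_def N add.commute)
  also have "\<dots> = (e1 * ?K 1 p + d' * ?K 1 (Suc p) + e2 * ?K 2 p + ?K 0 n) * D"
    using g[of p] shift[of 1] shift[of 2] shift[of 0]
    by (simp add: f h algebra_simps numeral_2_eq_2)
  finally have "trace N = e1 * ?K 1 p + d' * ?K 1 (Suc p) + e2 * ?K 2 p + ?K 0 n"
    using D by simp
  also have "\<dots> = packing_sum (cells n) (tile_weight d e) (cyclic_tiles n)"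
    unfolding packing_sum_cyclic[OF n] by (simp add: p e1_def e2_def d'_def)
  finally show "trace N = packing_sum (cells n) (tile_weight d e) (cyclic_tiles n)" .
  \<comment> \<open>Modulo \<open>V (k + 1)\<close> and \<open>V (k + 2)\<close>, the vector
    \<open>V (k + 3)\<close> is \<open>e k\<close> times \<open>V k\<close>. Rotating three vectors
    is an even permutation, so no sign appears.\<close>
  let ?B = "\<lambda>k. bracket (V k) (V (Suc k)) (V (Suc (Suc k)))"
  have "?B k = (\<Prod>t<k. e t) * ?B 0" for k
  proof (induction k)
    case (Suc k)
    have "?B (Suc k) = e k * ?B k" by (simp add: VS bracket_rotate)
    then show ?case using Suc by simp
  qed simp
  from this[of n] have "?B n = (\<Prod>t<n. e t) * ?B 0" .
  moreover have "?B n = det N * ?B 0" by (simp add: N flip: det_bracket)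
  moreover have "?B 0 \<noteq> 0" using ind[of 0] by (simp add: numeral_2_eq_2)
  ultimately show "det N = (\<Prod>t<n. e t)" by simp
qed

section \<open>Projective geometry in coordinates\<close>

definition cross :: "'a::field ^ 3 \<Rightarrow> 'a ^ 3 \<Rightarrow> 'a ^ 3" where
  "cross u v = vector [u $ 2 * v $ 3 - u $ 3 * v $ 2, u $ 3 * v $ 1 - u $ 1 * v $ 3,
     u $ 1 * v $ 2 - u $ 2 * v $ 1]"

lemma cross_components [simp]:
  "cross u v $ 1 = u $ 2 * v $ 3 - u $ 3 * v $ 2"
  "cross u v $ 2 = u $ 3 * v $ 1 - u $ 1 * v $ 3"
  "cross u v $ 3 = u $ 1 * v $ 2 - u $ 2 * v $ 1"
  by (simp_all add: cross_def)

lemma bracket_cramer: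
  "bracket u v w *s x = bracket x v w *s u + bracket u x w *s v + bracket u v x *s w"
  unfolding vec_eq_iff forall_3 bracket_def by (simp add: algebra_simps)

lemma span_pair: "vec.span {u, v} = {s *s u + t *s v | s t. True}"
proof -
  have "x \<in> vec.span {u, v} \<longleftrightarrow> (\<exists>s t. x = s *s u + t *s v)" for x
    unfolding vec.span_insert[of u] vec.span_singleton by (auto simp: image_iff algebra_simps)
  then show ?thesis by blast
qed

lemma join_span: "join (vec.span {u}) (vec.span {v}) = vec.span {u, v}"
proof -
  have "vec.span (vec.span {u} \<union> vec.span {v}) = vec.span ({u} \<union> {v})"
    by (rule antisym; rule vec.span_minimal)
      (auto intro: vec.span_base simp: vec.subspace_span vec.span_mono[THEN subsetD, of "{u}"]
        vec.span_mono[THEN subsetD, of "{v}"])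
  then show ?thesis by (simp add: join_def insert_commute)
qed

lemma join_commute: "join a b = join b a"
  by (simp add: join_def Un_commute)

lemma mem_span_pair_iff:
  assumes "bracket e u v \<noteq> 0"
  shows "x \<in> vec.span {u, v} \<longleftrightarrow> bracket x u v = 0"
proof
  assume "x \<in> vec.span {u, v}"
  then show "bracket x u v = 0" by (auto simp: span_pair)
next
  assume "bracket x u v = 0"
  then have "bracket e u v *s x = bracket e x v *s u + bracket e u x *s v"
    using bracket_cramer[of e u v x] by simp
  then have "inverse (bracket e u v) *s (bracket e u v *s x) =
      inverse (bracket e u v) *s (bracket e x v *s u + bracket e u x *s v)" by simp
  then have "x = (inverse (bracket e u v) * bracket e x v) *s u + (inverse (bracket e u v) * bracket e u x) *s v"
    using assms by (simp add: vec.scale_right_distrib)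
  then show "x \<in> vec.span {u, v}" unfolding span_pair by blast
qed

lemma span_scale: "c \<noteq> 0 \<Longrightarrow> vec.span {c *s v} = vec.span {v}"
  by (rule vec.span_image_scale[of "{v}" "\<lambda>_. c", simplified])

text \<open>A combination of \<open>a\<close> and \<open>b\<close> lies on the second line exactly
  if its bracket with \<open>c\<close> and \<open>d\<close> vanishes, a linear condition that fixes
  the ratio of the coefficients.\<close>

lemma meet_span:
  assumes "bracket a c d \<noteq> 0"
  shows "meet (join (vec.span {a}) (vec.span {b})) (join (vec.span {c}) (vec.span {d})) =
    vec.span {bracket b c d *s a - bracket a c d *s b}"
proof -
  let ?p = "bracket b c d *s a - bracket a c d *s b"
  have "x \<in> vec.span {a, b} \<inter> vec.span {c, d} \<longleftrightarrow> x \<in> vec.span {?p}" for x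
  proof
    assume "x \<in> vec.span {a, b} \<inter> vec.span {c, d}"
    then have "x \<in> vec.span {a, b}" "bracket x c d = 0"
      using mem_span_pair_iff[OF assms] by blast+
    moreover from this obtain s t where x: "x = s *s a + t *s b" by (auto simp: span_pair)
    ultimately have "s * bracket a c d = - t * bracket b c d" by (simp add: add_eq_0_iff)
    then have "s = (- t / bracket a c d) * bracket b c d" using assms by (simp add: field_simps)
    then have "x = (- t / bracket a c d) *s ?p" using assms unfolding x
      by (simp add: vec.scale_right_diff_distrib)
    then show "x \<in> vec.span {?p}" unfolding vec.span_singleton by (rule range_eqI)
  next
    assume "x \<in> vec.span {?p}"
    then obtain r where x: "x = r *s ?p" by (auto simp: vec.span_singleton)
    have "x \<in> vec.span {a, b}"
      unfolding x by (intro vec.span_diff vec.span_scale vec.span_base) auto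
    moreover have "bracket x c d = 0" by (simp add: x)
    ultimately show "x \<in> vec.span {a, b} \<inter> vec.span {c, d}" by (simp add: mem_span_pair_iff[OF assms])
  qed
  then show ?thesis by (auto simp: meet_def join_span)
qed

lemma independent_pair:
  assumes "bracket u v w \<noteq> 0"
  shows "u \<noteq> v" "vec.independent {u, v}"
proof -
  show "u \<noteq> v" using assms by auto
  have "u \<notin> vec.span {v}" using assms by (auto simp: vec.span_singleton)
  moreover have "v \<noteq> 0" using assms by (auto simp: bracket_def)
  ultimately show "vec.independent {u, v}" by (auto simp: vec.independent_insert)
qed

lemma proj_line_span_pair:
  assumes "bracket u v w \<noteq> 0"
  shows "proj_line (vec.span {u, v})"
proof -
  have "vec.dim (vec.span {u, v}) = card {u, v}"
    using vec.dim_eq_card_independent[OF independent_pair(2)[OF assms]] by simp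
  then show ?thesis
    using independent_pair(1)[OF assms] by (simp add: proj_line_def vec.subspace_span)
qed

lemma bracket_axis [simp]:
  "bracket u v (axis 1 1) = u $ 2 * v $ 3 - u $ 3 * v $ 2"
  "bracket u v (axis 2 1) = u $ 3 * v $ 1 - u $ 1 * v $ 3"
  "bracket u v (axis 3 1) = u $ 1 * v $ 2 - u $ 2 * v $ 1"
  by (simp_all add: bracket_def axis_def)

lemma mem_span_singletonI:
  assumes u: "u \<noteq> 0" and "\<And>w. bracket u v w = 0"
  shows "v \<in> vec.span {u}"
proof -
  obtain i where i: "u $ i \<noteq> 0" using u by (auto simp: vec_eq_iff)
  have "\<forall>i j. u $ i * v $ j = u $ j * v $ i"
    unfolding forall_3 using assms(2)[of "axis 1 1"] assms(2)[of "axis 2 1"] assms(2)[of "axis 3 1"]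
    by simp
  then have "u $ i * v $ j = u $ j * v $ i" for j by blast
  then have "v = (v $ i / u $ i) *s u" using i by (simp add: vec_eq_iff field_simps)
  then show ?thesis by (auto simp: vec.span_singleton)
qed

lemma exists_bracket_nonzero:
  fixes u :: "'a::field ^ 3"
  assumes "u \<noteq> 0"
  obtains v w where "bracket u v w \<noteq> 0"
proof -
  have "u $ 1 \<noteq> 0 \<or> u $ 2 \<noteq> 0 \<or> u $ 3 \<noteq> 0"
    using assms by (simp add: vec_eq_iff forall_3)
  moreover have "bracket u (axis 2 1) (axis 3 1) = u $ 1" "bracket u (axis 3 1) (axis 1 1) = u $ 2"
    "bracket u (axis 1 1) (axis 2 1) = u $ 3" by (simp_all) (simp_all add: axis_def)
  ultimately show thesis using that by metis
qed

text \<open>A vanishing bracket must produce a line through all three. If two of the vectors are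
  independent they span it; otherwise the line has to be completed by an auxiliary vector.\<close>

lemma bracket_nonzero_if_not_collinear:
  fixes u v w :: "'a::field ^ 3"
  assumes u: "u \<noteq> 0" and nc: "\<not> proj_collinear (vec.span {u}) (vec.span {v}) (vec.span {w})"
  shows "bracket u v w \<noteq> 0"
proof
  assume 0: "bracket u v w = 0"
  have sub: "vec.span {x} \<subseteq> vec.span {y, z}" if "x \<in> vec.span {y, z}" for x y z :: "'a ^ 3"
    using that by (simp add: vec.span_minimal vec.subspace_span)
  have no_line: False if "bracket y z c \<noteq> 0" "u \<in> vec.span {y, z}" "v \<in> vec.span {y, z}" "w \<in> vec.span {y, z}" for y z c
    using nc that proj_line_span_pair sub unfolding proj_collinear_def by metis
  have base: "y \<in> vec.span {y, z}" "z \<in> vec.span {y, z}" for y z :: "'a ^ 3"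
    by (auto intro: vec.span_base)
  have span1: "x \<in> vec.span {y, z}" if "x \<in> vec.span {y}" for x y z :: "'a ^ 3"
    using that vec.span_mono[of "{y}" "{y, z}"] by auto
  show False
  proof (cases "\<exists>c. bracket u v c \<noteq> 0")
    case True
    then obtain c where c: "bracket u v c \<noteq> 0" by blast
    then have "bracket c u v \<noteq> 0" by (simp add: bracket_rotate)
    moreover have "bracket w u v = 0" using 0 by (simp add: bracket_rotate)
    ultimately have "w \<in> vec.span {u, v}" using mem_span_pair_iff by blast
    then show False using no_line[OF c] base by blast
  next
    case False
    then have v: "v \<in> vec.span {u}" using mem_span_singletonI[OF u] by blast
    show False
    proof (cases "\<exists>c. bracket u w c \<noteq> 0")
      case True
      then show False using no_line v base span1 by metis
    next
      case False
      then have "w \<in> vec.span {u}" using mem_span_singletonI[OF u] by blast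
      \<comment> \<open>Everything lies in the span of \<open>u\<close>, so any line through that
        point serves.\<close>
      then show False using exists_bracket_nonzero[OF u] no_line v base span1 by metis
    qed
  qed
qed

section \<open>Cross ratios in terms of brackets\<close>

lemma affine_point_coordinates:
  assumes "x\<^sub>0 * y - y\<^sub>0 * x \<noteq> 0" "x\<^sub>0 \<noteq> 0"
  shows "vec.span {x *s a + y *s b} = affine_point (x\<^sub>0 *s a + y\<^sub>0 *s b) b (x / (x\<^sub>0 * y - y\<^sub>0 * x))"
proof -
  \<comment> \<open>The new point at infinity is \<open>x\<^sub>0 *s a + y\<^sub>0 *s b\<close> and
    the origin is \<open>b\<close>. That \<open>D\<close> is nonzero says that the point is not at
    infinity; \<open>x\<^sub>0 \<noteq> 0\<close> says that the origin is not.\<close>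
  define D where "D = x\<^sub>0 * y - y\<^sub>0 * x"
  have D: "D \<noteq> 0" using assms by (simp add: D_def)
  have eq: "1 + x / D * y\<^sub>0 = x\<^sub>0 / D * y" using D by (simp add: field_simps) (simp add: D_def)
  have "b + (x / D) *s (x\<^sub>0 *s a + y\<^sub>0 *s b) = (x / D * x\<^sub>0) *s a + (1 + x / D * y\<^sub>0) *s b"
    by (simp add: vec_eq_iff algebra_simps)
  also have "\<dots> = (x\<^sub>0 / D) *s (x *s a + y *s b)"
    unfolding eq by (simp add: vec_eq_iff algebra_simps)
  finally have pt: "b + (x / D) *s (x\<^sub>0 *s a + y\<^sub>0 *s b) = (x\<^sub>0 / D) *s (x *s a + y *s b)" .
  have "x\<^sub>0 / D \<noteq> 0" using D assms(2) by simp
  then show ?thesis unfolding affine_point_def D_def[symmetric] pt by (rule span_scale[symmetric])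
qed

text \<open>The fifth point \<open>(ab)(uw)\<close> serves as the point at infinity of the coordinate; over the field
  with four elements there is no other choice.\<close>

lemma inverse_cross_ratio_five_points:
  assumes "bracket a b u \<noteq> 0" "bracket a b w \<noteq> 0" "bracket u v w \<noteq> 0"
    "bracket a u v \<noteq> 0" "bracket a v w \<noteq> 0" "bracket a u w \<noteq> 0"
    "bracket b v w \<noteq> 0" "bracket b u w \<noteq> 0"
  shows "inverse_cross_ratio (vec.span {a}) (vec.span {b})
      (meet (join (vec.span {a}) (vec.span {b})) (join (vec.span {u}) (vec.span {v})))
      (meet (join (vec.span {a}) (vec.span {b})) (join (vec.span {v}) (vec.span {w}))) =
    1 - bracket b u v * bracket a v w / (bracket a u v * bracket b v w)"
proof -
  \<comment> \<open>These are the coefficients that \<open>meet_span\<close> gives for the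
    intersection of the lines \<open>ab\<close> and \<open>uw\<close>.\<close>
  define x y where "x = bracket b u w" and "y = - bracket a u w"
  define e where "e = x *s a + y *s b"
  have xy: "x \<noteq> 0" "y \<noteq> 0" using assms by (simp_all add: x_def y_def)
  \<comment> \<open>By three-term Pluecker relations both are, up to sign, products of brackets
    assumed nonzero: neither intersection point is at infinity.\<close>
  let ?c = "x * - bracket a u v - y * bracket b u v" and ?d = "x * - bracket a v w - y * bracket b v w"
  have "?c = - bracket a b u * bracket u v w"
    unfolding x_def y_def bracket_def by algebra
  moreover have "?d = bracket a b w * bracket u v w"
    unfolding x_def y_def bracket_def by algebra
  ultimately have cd: "?c \<noteq> 0" "?d \<noteq> 0" using assms by simp_all
  have "bracket e b u \<noteq> 0" using assms xy by (simp add: e_def)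
  note ind = independent_pair[OF this]
  have "vec.span {a} = affine_point e b (- 1 / y)" "vec.span {b} = affine_point e b 0"
    using affine_point_coordinates[of x 0 y 1 a b] affine_point_coordinates[of x 1 y 0 a b] xy
    by (simp_all add: e_def)
  moreover have "meet (join (vec.span {a}) (vec.span {b})) (join (vec.span {u}) (vec.span {v})) =
      affine_point e b (bracket b u v / ?c)"
    using affine_point_coordinates[OF cd(1) xy(1), of a b] assms by (simp add: meet_span e_def)
  moreover have "meet (join (vec.span {a}) (vec.span {b})) (join (vec.span {v}) (vec.span {w})) =
      affine_point e b (bracket b v w / ?d)"
    using affine_point_coordinates[OF cd(2) xy(1), of a b] assms by (simp add: meet_span e_def)
  ultimately have "inverse_cross_ratio (vec.span {a}) (vec.span {b})
      (meet (join (vec.span {a}) (vec.span {b})) (join (vec.span {u}) (vec.span {v})))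
      (meet (join (vec.span {a}) (vec.span {b})) (join (vec.span {v}) (vec.span {w}))) =
      (- 1 / y - 0) * (bracket b u v / ?c - bracket b v w / ?d) /
      ((- 1 / y - bracket b u v / ?c) * (0 - bracket b v w / ?d))"
    using inverse_cross_ratio_eq[OF ind] by simp
  also have "- 1 / y - bracket b u v / ?c = x * bracket a u v / (y * ?c)"
    using cd xy by (simp add: divide_simps)
  also have "bracket b u v / ?c - bracket b v w / ?d =
      x * (bracket b v w * bracket a u v - bracket b u v * bracket a v w) / (?c * ?d)"
    using cd xy by (simp add: divide_simps) (simp add: algebra_simps)
  also have "(- 1 / y - 0) * (x * (bracket b v w * bracket a u v - bracket b u v * bracket a v w) / (?c * ?d)) /
      (x * bracket a u v / (y * ?c) * (0 - bracket b v w / ?d)) =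
      (bracket b v w * bracket a u v - bracket b u v * bracket a v w) / (bracket a u v * bracket b v w)"
    using cd xy assms by (simp add: divide_simps)
  also have "\<dots> = 1 - bracket b u v * bracket a v w / (bracket a u v * bracket b v w)"
    using assms by (simp add: field_simps)
  finally show ?thesis .
qed

section \<open>The recurrence of a PolyPoint\<close>

text \<open>By Cramer's rule the last property says that \<open>w (k + 2)\<close> has coefficient 1
  in the expansion of \<open>w (k + 3)\<close>. It is achieved by rescaling the lifts one after the
  other.\<close>

lemma obtain_normalized_lifts:
  fixes A :: "int \<Rightarrow> ('a::field ^ 3) set"
  assumes points: "\<And>j. j mod 4 = 1 \<Longrightarrow> proj_point (A j)" and nondeg: "nondegenerate A"
    and m: "m mod 4 = 1"
  obtains w :: "nat \<Rightarrow> 'a ^ 3" where "\<And>k. w k \<noteq> 0" "\<And>k. A (m + 4 * int k) = vec.span {w k}"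
    "\<And>k r s t. r < s \<Longrightarrow> s < t \<Longrightarrow> t \<le> 4 \<Longrightarrow> bracket (w (k + r)) (w (k + s)) (w (k + t)) \<noteq> 0"
    "\<And>k. bracket (w k) (w (k + 1)) (w (k + 3)) = bracket (w k) (w (k + 1)) (w (k + 2))"
proof -
  have m4: "(m + 4 * int k) mod 4 = 1" for k using m by simp
  have "\<exists>v. v \<noteq> 0 \<and> A (m + 4 * int k) = vec.span {v}" for k
    using proj_pointE[OF points[OF m4]] by metis
  then obtain v where v: "\<And>k. v k \<noteq> 0" "\<And>k. A (m + 4 * int k) = vec.span {v k}" by metis
  have br: "bracket (v (k + r)) (v (k + s)) (v (k + t)) \<noteq> 0" if "r < s" "s < t" "t \<le> 4" for k r s t
  proof (rule bracket_nonzero_if_not_collinear[OF v(1)])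
    have "\<not> proj_collinear (A (m + 4 * int k + 4 * int r)) (A (m + 4 * int k + 4 * int s))
        (A (m + 4 * int k + 4 * int t))"
      using nondeg m4[of k] that unfolding nondegenerate_def by simp
    then show "\<not> proj_collinear (vec.span {v (k + r)}) (vec.span {v (k + s)}) (vec.span {v (k + t)})"
      unfolding v(2)[symmetric] by (simp add: algebra_simps)
  qed
  define c where "c k = bracket (v k) (v (k + 1)) (v (k + 2)) / bracket (v k) (v (k + 1)) (v (k + 3))" for k
  have c: "c k \<noteq> 0" for k using br[of 0 1 2 k] br[of 0 1 3 k] by (simp add: c_def)
  \<comment> \<open>The truncated subtraction gives the first three vectors the factor 1; from then
    on each step contributes one \<open>c i\<close>.\<close>
  define l where "l k = (\<Prod>i<k - 2. c i)" for k
  have l: "l k \<noteq> 0" for k using c by (simp add: l_def)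
  have l3: "l (k + 3) = c k * l (k + 2)" for k
    by (simp add: l_def numeral_3_eq_3 numeral_2_eq_2)
  have "bracket (v k) (v (k + 1)) (v (k + 3)) * c k = bracket (v k) (v (k + 1)) (v (k + 2))" for k
    using br[of 0 1 3 k] by (simp add: c_def)
  then have "bracket (l k *s v k) (l (k + 1) *s v (k + 1)) (l (k + 3) *s v (k + 3)) =
      bracket (l k *s v k) (l (k + 1) *s v (k + 1)) (l (k + 2) *s v (k + 2))" for k
    by (simp add: l3 ac_simps)
  then show thesis
    using that[of "\<lambda>k. l k *s v k"] v l br by (simp add: span_scale)
qed

text \<open>Applying \<open>M\<close> to the normalization equates the multipliers at
  \<open>k + 3\<close> and \<open>k + 2\<close>. Those at 0 and 1 remain unrelated, hence the shift
  by 2 in the conclusion.\<close>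

lemma monodromy_normalized_lifts:
  fixes w :: "nat \<Rightarrow> 'a::field ^ 3"
  assumes T: "is_lift M T"
    and w: "\<And>k. w k \<noteq> 0" "\<And>k. T (vec.span {w k}) = vec.span {w (k + n)}"
    and nz: "\<And>k. bracket (w k) (w (k + 1)) (w (k + 2)) \<noteq> 0"
    and norm: "\<And>k. bracket (w k) (w (k + 1)) (w (k + 3)) = bracket (w k) (w (k + 1)) (w (k + 2))"
  obtains c where "c \<noteq> 0" "\<And>k. M *v w (k + 2) = c *s w (k + 2 + n)"
proof -
  have M: "invertible M" using T by (simp add: is_lift_def)
  have "\<exists>r. M *v w k = r *s w (k + n)" for k
  proof -
    have "M *v w k \<in> vec.span {w (k + n)}"
      using is_lift_span[OF T w(1)[of k]] w(2)[of k] by (auto intro: vec.span_base)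
    then show ?thesis by (auto simp: vec.span_singleton)
  qed
  then obtain r where r: "\<And>k. M *v w k = r k *s w (k + n)" by metis
  have r0: "r k \<noteq> 0" for k
    using invertible_mult_nonzero[OF M w(1)[of k]] r[of k] by auto
  have "r (k + 3) = r (k + 2)" for k
  proof -
    have "bracket (M *v w k) (M *v w (k + 1)) (M *v w (k + 3)) =
        bracket (M *v w k) (M *v w (k + 1)) (M *v w (k + 2))"
      unfolding det_bracket norm ..
    moreover have "k + 1 + n = k + n + 1" "k + 2 + n = k + n + 2" "k + 3 + n = k + n + 3" by simp_all
    ultimately have "r k * (r (k + 1) * (r (k + 3) * bracket (w (k + n)) (w (k + n + 1)) (w (k + n + 2)))) =
        r k * (r (k + 1) * (r (k + 2) * bracket (w (k + n)) (w (k + n + 1)) (w (k + n + 2))))"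
      unfolding r by (auto simp: norm[of "k + n", simplified])
    then show ?thesis using r0[of k] r0[of "k + 1"] nz[of "k + n"] by (simp del: One_nat_def add_2_eq_Suc' add_Suc_right)
  qed
  then have "r (Suc k + 2) = r (k + 2)" for k by (simp add: eval_nat_numeral)
  then have "r (k + 2) = r 2" for k by (induction k) (simp_all add: numeral_2_eq_2)
  then show thesis using that[OF r0[of 2]] r by metis
qed

context
  fixes U0 U1 U2 U3 U4 :: "'a::field ^ 3" and b0 c0 b1 c1 :: 'a
  assumes U3: "U3 = U2 + b0 *s U1 + c0 *s U0" and U4: "U4 = U3 + b1 *s U2 + c1 *s U1"
    and nz: "bracket U0 U1 U2 \<noteq> 0" "c0 \<noteq> 0"
begin

private lemma perm:
  "bracket U0 U2 U1 = - bracket U0 U1 U2" "bracket U1 U0 U2 = - bracket U0 U1 U2"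
  "bracket U1 U2 U0 = bracket U0 U1 U2" "bracket U2 U0 U1 = bracket U0 U1 U2"
  "bracket U2 U1 U0 = - bracket U0 U1 U2"
  by (simp_all add: bracket_def algebra_simps)

text \<open>The left side is the cross ratio formula for the five points in reverse order, as in
  \<open>p_inv\<close>.\<close>

lemma recurrence_second_coefficient:
  "1 - bracket U3 U2 U1 * bracket U4 U1 U0 / (bracket U4 U2 U1 * bracket U3 U1 U0) = - b1"
  using nz by (simp add: U4 U3 perm field_simps)

text \<open>Here the five points are in forward order, as in \<open>q_inv\<close>. Solved for
  \<open>c1\<close>, this gives the product of one \<open>q\<close> and two neighbouring
  \<open>p\<close>, the signs cancelling.\<close>

lemma recurrence_third_coefficient:
  "b0 \<noteq> 0 \<Longrightarrow> b1 \<noteq> 0 \<Longrightarrow>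
    1 - bracket U1 U2 U3 * bracket U0 U3 U4 / (bracket U0 U2 U3 * bracket U1 U3 U4) = c1 / (b0 * b1)"
  using nz by (simp add: U4 U3 perm field_simps)

end


lemma obtain_polypoint_recurrence:
  fixes A :: "int \<Rightarrow> ('a::field ^ 3) set"
  assumes poly: "polypoint n A T" and nondeg: "nondegenerate A"
  defines "X \<equiv> proj_invariant A"
  obtains M V c where "is_lift M T" "c \<noteq> 0" "\<And>k. M *v V k = c *s V (k + n)"
    "\<And>k. V (k + 3) = V (k + 2) + (- X (2 * k + 3)) *s V (k + 1) +
      (X (2 * k + 1) * X (2 * k + 2) * X (2 * k + 3)) *s V k"
    "\<And>k. bracket (V k) (V (k + 1)) (V (k + 2)) \<noteq> 0"
    "\<And>i. X (i + 2 * n) = X i" "\<And>k. X (2 * k + 1) \<noteq> 0"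
proof -
  have points: "proj_point (A j)" "T (A j) = A (j + 4 * int n)" if "j mod 4 = 1" for j
    using poly that by (auto simp: polypoint_def)
  obtain M where M: "is_lift M T"
    using poly by (auto simp: polypoint_def proj_transformation_def)
  \<comment> \<open>Two lifts will be dropped to make the multiplier constant. Starting at -15, the
    remaining \<open>u k\<close> lifts the point with index \<open>4 * k - 7\<close>, and
    \<open>u k\<close> to \<open>u (k + 4)\<close> are the five points that enter both
    \<open>X (2 * k)\<close> and \<open>X (2 * k + 1)\<close>.\<close>
  obtain w :: "nat \<Rightarrow> 'a ^ 3" where w: "\<And>k. w k \<noteq> 0" "\<And>k. A (- 15 + 4 * int k) = vec.span {w k}"
    and wbr: "\<And>k r s t. r < s \<Longrightarrow> s < t \<Longrightarrow> t \<le> 4 \<Longrightarrow> bracket (w (k + r)) (w (k + s)) (w (k + t)) \<noteq> 0"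
    and wnorm: "\<And>k. bracket (w k) (w (k + 1)) (w (k + 3)) = bracket (w k) (w (k + 1)) (w (k + 2))"
    by (rule obtain_normalized_lifts[OF points(1) nondeg, of "- 15"]) auto
  have Tw: "T (vec.span {w k}) = vec.span {w (k + n)}" for k
  proof -
    have "(- 15 + 4 * int k) mod 4 = 1" by presburger
    then show ?thesis using points(2)[of "- 15 + 4 * int k"] w(2)[of k] w(2)[of "k + n"]
      by (simp add: algebra_simps)
  qed
  obtain c where c: "c \<noteq> 0" "\<And>k. M *v w (k + 2) = c *s w (k + 2 + n)"
    using monodromy_normalized_lifts[OF M w(1) Tw _ wnorm] wbr[of 0 1 2] by auto
  define u where "u k = w (k + 2)" for k
  have u: "A (- 7 + 4 * int k) = vec.span {u k}" for k
    using w(2)[of "k + 2"] by (simp add: u_def algebra_simps)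
  have ubr: "bracket (u (k + r)) (u (k + s)) (u (k + t)) \<noteq> 0" if "r < s" "s < t" "t \<le> 4" for k r s t
    using wbr[OF that, of "k + 2"] by (simp add: u_def algebra_simps)
  have unorm: "bracket (u k) (u (k + 1)) (u (k + 3)) = bracket (u k) (u (k + 1)) (u (k + 2))" for k
    using wnorm[of "k + 2"] by (simp add: u_def algebra_simps)
  have Mu: "M *v u k = c *s u (k + n)" for k
    using c(2)[of k] by (simp add: u_def algebra_simps)
  define D where "D k = bracket (u k) (u (k + 1)) (u (k + 2))" for k
  define b where "b k = bracket (u k) (u (k + 3)) (u (k + 2)) / D k" for k
  define e where "e k = bracket (u (k + 3)) (u (k + 1)) (u (k + 2)) / D k" for k
  have D: "D k \<noteq> 0" for k using ubr[of 0 1 2 k] by (simp add: D_def)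
  have b: "b k \<noteq> 0" for k
    using ubr[of 0 2 3 k] D[of k] bracket_swap(2)[of "u k" "u (k + 3)" "u (k + 2)"] by (simp add: b_def)
  have e: "e k \<noteq> 0" for k
    using ubr[of 1 2 3 k] D[of k] unfolding e_def by (simp add: bracket_rotate[of "u (k + 3)"] bracket_rotate[of _ "u (k + 3)"])
  have rec: "u (k + 3) = u (k + 2) + b k *s u (k + 1) + e k *s u k" for k
  proof -
    have "D k *s u (k + 3) = bracket (u (k + 3)) (u (k + 1)) (u (k + 2)) *s u k +
        bracket (u k) (u (k + 3)) (u (k + 2)) *s u (k + 1) + D k *s u (k + 2)"
      using bracket_cramer[of "u k" "u (k + 1)" "u (k + 2)" "u (k + 3)"] unfolding unorm D_def .
    also have "\<dots> = D k *s (u (k + 2) + b k *s u (k + 1) + e k *s u k)"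
      using D[of k] by (simp add: vec.scale_right_distrib b_def e_def)
    finally show ?thesis using D[of k] by (simp only: vec.scale_cancel_left simp_thms)
  qed
  have rec': "u (k + 4) = u (k + 3) + b (k + 1) *s u (k + 2) + e (k + 1) *s u (k + 1)" for k
  proof -
    have "k + 1 + 3 = k + 4" "k + 1 + 2 = k + 3" "k + 1 + 1 = k + 2" by simp_all
    then show ?thesis using rec[of "k + 1"] by (simp only:)
  qed
  have nz: "bracket (u k) (u (k + 1)) (u (k + 2)) \<noteq> 0" "bracket (u k) (u (k + 1)) (u (k + 3)) \<noteq> 0"
    "bracket (u k) (u (k + 1)) (u (k + 4)) \<noteq> 0" "bracket (u k) (u (k + 2)) (u (k + 3)) \<noteq> 0"
    "bracket (u k) (u (k + 2)) (u (k + 4)) \<noteq> 0" "bracket (u k) (u (k + 3)) (u (k + 4)) \<noteq> 0"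
    "bracket (u (k + 1)) (u (k + 2)) (u (k + 3)) \<noteq> 0" "bracket (u (k + 1)) (u (k + 2)) (u (k + 4)) \<noteq> 0"
    "bracket (u (k + 1)) (u (k + 3)) (u (k + 4)) \<noteq> 0" "bracket (u (k + 2)) (u (k + 3)) (u (k + 4)) \<noteq> 0" for k
    using ubr[of 0 1 2 k] ubr[of 0 1 3 k] ubr[of 0 1 4 k] ubr[of 0 2 3 k] ubr[of 0 2 4 k] ubr[of 0 3 4 k] ubr[of 1 2 3 k] ubr[of 1 2 4 k] ubr[of 1 3 4 k] ubr[of 2 3 4 k]
    by simp_all
  have nz': "bracket z y x \<noteq> 0" if "bracket x y z \<noteq> 0" for x y z :: "'a ^ 3"
    using that by (simp add: bracket_def algebra_simps)
  have A_eq: "A (9 + 4 * int k) = vec.span {u (k + 4)}" "A (5 + 4 * int k) = vec.span {u (k + 3)}"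
    "A (1 + 4 * int k) = vec.span {u (k + 2)}" "A (- 3 + 4 * int k) = vec.span {u (k + 1)}" for k
    using u[of "k + 4"] u[of "k + 3"] u[of "k + 2"] u[of "k + 1"] by (simp_all add: algebra_simps)
  have X_odd: "X (2 * k + 1) = - b (k + 1)" for k
  proof -
    let ?A = "\<lambda>i. A (i + 4 * int k)"
    have "X (2 * k + 1) = inverse_cross_ratio (?A 9) (?A 5)
        (meet (join (?A 9) (?A 5)) (join (?A 1) (?A (- 3))))
        (meet (join (?A 9) (?A 5)) (join (?A (- 3)) (?A (- 7))))"
      by (simp add: X_def proj_invariant_def p_inv_def poly_line_def Let_def algebra_simps join_commute)
    also have "\<dots> = - b (k + 1)"
      unfolding A_eq u
      by (rule trans[OF inverse_cross_ratio_five_points recurrence_second_coefficient[OF rec rec' nz(1) e]])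
        (rule nz', rule nz)+
    finally show ?thesis .
  qed
  have X_even: "X (2 * k) = e (k + 1) / (b k * b (k + 1))" for k
  proof -
    let ?A = "\<lambda>i. A (i + 4 * int k)"
    have "X (2 * k) = inverse_cross_ratio (?A (- 7)) (?A (- 3))
        (meet (join (?A (- 7)) (?A (- 3))) (join (?A 1) (?A 5)))
        (meet (join (?A (- 7)) (?A (- 3))) (join (?A 5) (?A 9)))"
      by (simp add: X_def proj_invariant_def q_inv_def poly_line_def Let_def algebra_simps join_commute)
    also have "\<dots> = e (k + 1) / (b k * b (k + 1))"
      unfolding A_eq u
      by (rule trans[OF inverse_cross_ratio_five_points recurrence_third_coefficient[OF rec rec' nz(1) e b b]])
        (rule nz)+
    finally show ?thesis .
  qed
  \<comment> \<open>The monodromy multiplies all brackets by the same factor \<open>q\<close>, which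
    cancels in the quotients defining \<open>b\<close> and \<open>e\<close>.\<close>
  have period: "b (k + n) = b k" "e (k + n) = e k" for k
  proof -
    define q where "q = det M / c ^ 3"
    have M0: "det M \<noteq> 0" using M by (simp add: is_lift_def invertible_det_nz)
    have "c ^ 3 * bracket (u (i + n)) (u (j + n)) (u (l + n)) = det M * bracket (u i) (u j) (u l)" for i j l
      unfolding det_bracket[symmetric] Mu by (simp add: power3_eq_cube)
    then have q: "bracket (u (i + n)) (u (j + n)) (u (l + n)) = q * bracket (u i) (u j) (u l)" for i j l
      using c(1) by (simp add: q_def field_simps)
    have "k + n + i = k + i + n" for i by simp
    then show "b (k + n) = b k" "e (k + n) = e k"
      using M0 c(1) unfolding b_def e_def D_def by (simp_all only: q) (simp_all add: q_def)
  qed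
  show thesis
  \<comment> \<open>The shift by 2 makes \<open>V k\<close> a lift of the point with index
    \<open>4 * k + 1\<close> and turns the coefficients into invariants with indices
    \<open>2 * k + 1\<close> to \<open>2 * k + 3\<close>.\<close>
  proof (rule that[of M c "\<lambda>k. u (k + 2)"])
    fix k
    show "M *v u (k + 2) = c *s u (k + n + 2)" using Mu[of "k + 2"] by (simp add: algebra_simps)
    show "bracket (u (k + 2)) (u (k + 1 + 2)) (u (k + 2 + 2)) \<noteq> 0"
      using ubr[of 0 1 2 "k + 2"] by (simp add: algebra_simps)
    have X: "X (2 * k + 1) = - b (k + 1)" "X (2 * k + 2) = e (k + 2) / (b (k + 1) * b (k + 2))"
      "X (2 * k + 3) = - b (k + 2)"
      using X_odd[of k] X_even[of "k + 1"] X_odd[of "k + 1"] by (simp_all add: eval_nat_numeral)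
    then show "X (2 * k + 1) \<noteq> 0" using b by simp
    have "u (k + 3 + 2) = u (k + 2 + 2) + b (k + 2) *s u (k + 1 + 2) + e (k + 2) *s u (k + 2)"
    proof -
      have "k + 2 + 3 = k + 3 + 2" "k + 2 + 1 = k + 1 + 2" by simp_all
      then show ?thesis using rec[of "k + 2"] by (simp only:)
    qed
    then show "u (k + 3 + 2) = u (k + 2 + 2) + (- X (2 * k + 3)) *s u (k + 1 + 2) +
        (X (2 * k + 1) * X (2 * k + 2) * X (2 * k + 3)) *s u (k + 2)"
      unfolding X using b by simp
    show "X (k + 2 * n) = X k"
    proof (cases "even k")
      case True
      then obtain i where "k = 2 * i" by (rule evenE)
      then show ?thesis using X_even[of i] X_even[of "i + n"] period(1)[of i] period[of "i + 1"]
        by (simp add: algebra_simps)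
    next
      case False
      then obtain i where "k = 2 * i + 1" by (rule oddE)
      then show ?thesis using X_odd[of i] X_odd[of "i + n"] period(1)[of "i + 1"]
        by (simp add: algebra_simps)
    qed
  qed (use M c in auto)
qed

section \<open>Monodromy invariants\<close>

lemma pent_invariant_top:
  assumes n: "n \<ge> 1" and s: "s < 2"
  shows "pent_invariant (\<lambda>i. odd (i + s)) n x n = (\<Prod>t<n. x (pos s t))"
    and "pent_invariant (\<lambda>i. even (i + s)) n x n = (\<Prod>t<n. x (cyc n (pos s t + 1)))"
proof -
  have "pos s ` {..<n} = {i \<in> {1..2 * n}. odd (i + s)}"
  proof (intro equalityI subsetI)
    fix i assume "i \<in> {i \<in> {1..2 * n}. odd (i + s)}"
    then show "i \<in> pos s ` {..<n}" using pos_surj[of i n s] s by blast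
  qed (use pos_range[OF _ s] in auto)
  moreover have "inj_on (pos s) {..<n}" by (simp add: inj_on_def)
  ultimately have "(\<Prod>i\<in>{i \<in> {1..2 * n}. odd (i + s)}. x i) = (\<Prod>t<n. x (pos s t))"
    by (metis (no_types, lifting) prod.reindex_cong)
  then show "pent_invariant (\<lambda>i. odd (i + s)) n x n = (\<Prod>t<n. x (pos s t))"
    using n by (simp add: pent_invariant_def)
  have "(\<lambda>t. cyc n (pos s t + 1)) ` {..<n} = {i \<in> {1..2 * n}. even (i + s)}"
  proof (intro equalityI subsetI)
    fix i assume "i \<in> {i \<in> {1..2 * n}. even (i + s)}"
    then show "i \<in> (\<lambda>t. cyc n (pos s t + 1)) ` {..<n}" using middle_surj[of i n s] s by blast
  next
    fix i assume "i \<in> (\<lambda>t. cyc n (pos s t + 1)) ` {..<n}"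
    then show "i \<in> {i \<in> {1..2 * n}. even (i + s)}" using middle_pos(1,2)[OF _ s] by blast
  qed
  moreover have "inj_on (\<lambda>t. cyc n (pos s t + 1)) {..<n}"
  proof (rule inj_onI)
    fix t t' assume t: "t \<in> {..<n}" "t' \<in> {..<n}" "cyc n (pos s t + 1) = cyc n (pos s t' + 1)"
    then have "pos s t = pos s t'" using middle_pos(3)[of t n s] middle_pos(3)[of t' n s] s by simp
    then show "t = t'" by simp
  qed
  ultimately have "(\<Prod>i\<in>{i \<in> {1..2 * n}. even (i + s)}. x i) = (\<Prod>t<n. x (cyc n (pos s t + 1)))"
    by (metis (no_types, lifting) prod.reindex_cong)
  then show "pent_invariant (\<lambda>i. even (i + s)) n x n = (\<Prod>t<n. x (cyc n (pos s t + 1)))"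
    using n by (simp add: pent_invariant_def)
qed

lemma packing_sum_cong:
  "(\<And>t. t \<in> T \<Longrightarrow> w t = w' t) \<Longrightarrow> packing_sum B w T = packing_sum B w' T"
  unfolding packing_sum_def by (intro sum.cong prod.cong) auto

lemma periodic_cyc:
  assumes "\<And>i. X (i + 2 * n) = X i" and n: "n \<ge> 1" and i: "i \<ge> 1"
  shows "X (cyc n i) = X i"
proof -
  have period: "X (r + q * (2 * n)) = X r" for r q
  proof (induction q)
    case (Suc q)
    then show ?case using assms(1)[of "r + q * (2 * n)"] by (simp add: algebra_simps)
  qed simp
  have "i + (2 * n - 1) = (i - 1) + 2 * n" using i n by simp
  then have "cyc n i = (i - 1) mod (2 * n) + 1" by (simp add: cyc_def)
  moreover have "(i - 1) mod (2 * n) + 1 + (i - 1) div (2 * n) * (2 * n) = i"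
    using i mod_div_mult_eq[of "i - 1" "2 * n"] by linarith
  ultimately show ?thesis using period[of "(i - 1) mod (2 * n) + 1" "(i - 1) div (2 * n)"] by simp
qed

text \<open>Shared by points (\<open>s = 0\<close>) and lines (\<open>s = 1\<close>). The square in
  the determinant arises because each index of the chosen parity is the first index of one trimer
  weight and the last of another.\<close>

lemma
  fixes V :: "nat \<Rightarrow> 'a::field ^ 3"
  assumes n: "n \<ge> 3" and s: "s < 2"
    and X: "\<And>i. X (i + 2 * n) = X i" "\<And>i. i \<in> {1..2 * n} \<Longrightarrow> x i = X i"
    and V: "\<And>k. V (k + 3) = V (k + 2) + (- X (pos s k + 2)) *s V (k + 1) +
      (X (pos s k) * X (pos s k + 1) * X (pos s k + 2)) *s V k"
    and N: "\<And>k. N *v V k = V (k + n)"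
    and ind: "\<And>k. bracket (V k) (V (k + 1)) (V (k + 2)) \<noteq> 0"
  shows trace_pent_invariants: "trace N = (\<Sum>k=0..n div 2. pent_invariant (\<lambda>i. odd (i + s)) n x k)"
    and det_pent_invariants: "det N = (pent_invariant (\<lambda>i. odd (i + s)) n x n)\<^sup>2 *
      pent_invariant (\<lambda>i. even (i + s)) n x n"
proof -
  define d where "d k = - X (pos s k)" for k
  define e where "e k = X (pos s k) * X (pos s k + 1) * X (pos s k + 2)" for k
  have pos: "pos s (k + 1) = pos s k + 2" "pos s (k + n) = pos s k + 2 * n" for k
    by (simp_all add: pos_def)
  have "pos s k + 2 * n + j = pos s k + j + 2 * n" for k j by simp
  then have period: "d (k + n) = d k" "e (k + n) = e k" for k
    unfolding d_def e_def pos by (simp_all only: X(1))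
  have V': "V (k + 3) = V (k + 2) + d (k + 1) *s V (k + 1) + e k *s V k" for k
    using V[of k] by (simp only: d_def e_def pos)
  have Xx: "X i = x (cyc n i)" if "i \<ge> 1" for i
  proof -
    have "cyc n i \<in> {1..2 * n}" using n by (auto simp: cyc_def Suc_le_eq)
    then show ?thesis using periodic_cyc[of X n i, OF X(1) _ that] X(2) n by simp
  qed
  have x: "X (pos s t) = x (pos s t)" "X (pos s t + 1) = x (cyc n (pos s t + 1))"
    "X (pos s t + 2) = x (pos s ((t + 1) mod n))" if "t < n" for t
    using Xx[of "pos s t"] Xx[of "pos s t + 1"] Xx[of "pos s (t + 1)"] cyc_pos[of n s t]
      cyc_pos[of n s "t + 1"] that n s by (simp_all add: pos_def)
  have "trace N = packing_sum (cells n) (tile_weight d e) (cyclic_tiles n)"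
    by (rule trace_recurrence[OF n V' period N ind])
  also have "\<dots> = packing_sum (cells n) (tile_weight (\<lambda>t. - x (pos s t))
      (\<lambda>t. x (pos s t) * x (cyc n (pos s t + 1)) * x (pos s ((t + 1) mod n)))) (cyclic_tiles n)"
    by (rule packing_sum_cong) (auto simp: cyclic_tiles_def tile_weight_def d_def e_def x[simplified])
  also have "\<dots> = (\<Sum>k=0..n div 2. pent_invariant (\<lambda>i. odd (i + s)) n x k)"
    by (rule sum_pent_invariant[OF n s, symmetric])
  finally show "trace N = (\<Sum>k=0..n div 2. pent_invariant (\<lambda>i. odd (i + s)) n x k)" .
  have "(\<lambda>t. (t + 1) mod n) ` {..<n} = {..<n}"
  proof (rule card_subset_eq)
    have "inj_on (\<lambda>t. (t + 1) mod n) {..<n}"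
      by (rule inj_onI) (metis cong_add_rcancel_nat cong_def lessThan_iff mod_less)
    then show "card ((\<lambda>t. (t + 1) mod n) ` {..<n}) = card {..<n}" by (rule card_image)
  qed (use n in auto)
  then have "bij_betw (\<lambda>t. (t + 1) mod n) {..<n} {..<n}"
    by (simp add: bij_betw_def eq_card_imp_inj_on)
  then have shift: "(\<Prod>t<n. x (pos s ((t + 1) mod n))) = (\<Prod>t<n. x (pos s t))"
    by (rule prod.reindex_bij_betw)
  have "det N = (\<Prod>t<n. e t)"
    by (rule det_recurrence[OF n V' period N ind])
  also have "\<dots> = (\<Prod>t<n. x (pos s t) * x (cyc n (pos s t + 1)) * x (pos s ((t + 1) mod n)))"
    by (rule prod.cong[OF refl]) (simp add: e_def x[simplified])
  also have "\<dots> = (pent_invariant (\<lambda>i. odd (i + s)) n x n)\<^sup>2 * pent_invariant (\<lambda>i. even (i + s)) n x n"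
    using n s by (simp only: pent_invariant_top prod.distrib shift) (simp add: power2_eq_square pent_invariant_top)
  finally show "det N = (pent_invariant (\<lambda>i. odd (i + s)) n x n)\<^sup>2 *
      pent_invariant (\<lambda>i. even (i + s)) n x n" .
qed

definition scale_matrix :: "'a::field \<Rightarrow> 'a ^ 3 ^ 3 \<Rightarrow> 'a ^ 3 ^ 3" where
  "scale_matrix c M = (\<chi> i j. c * M $ i $ j)"

lemma scale_matrix_mult: "scale_matrix c M *v v = c *s (M *v v)"
  by (simp add: scale_matrix_def vec_eq_iff matrix_vector_mult_def sum_distrib_left mult.assoc)

lemma trace_det_scale_matrix:
  assumes "c \<noteq> 0"
  shows "trace (scale_matrix c M) ^ 3 / det (scale_matrix c M) = trace M ^ 3 / det M"
proof -
  have "trace (scale_matrix c M) = c * trace M"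
    by (simp add: scale_matrix_def trace_def sum_distrib_left)
  moreover have "det (scale_matrix c M) = c ^ 3 * det M"
    by (simp add: scale_matrix_def det_3 algebra_simps power3_eq_cube)
  ultimately show ?thesis using assms by (simp add: power_mult_distrib)
qed

section \<open>Lines as cross products and their recurrence\<close>

lemma cross_scale: "cross (a *s u) (b *s v) = (a * b) *s cross u v"
  by (simp add: vec_eq_iff forall_3 algebra_simps)

text \<open>Paired with any \<open>w\<close>, both sides give the bracket of \<open>M *v u\<close>,
  \<open>M *v v\<close>, \<open>M *v w\<close>.\<close>

lemma transpose_mult_cross: "transpose M *v cross (M *v u) (M *v v) = det M *s cross u v"
proof -
  have T: "(transpose M *v z) $ i = M $ 1 $ i * z $ 1 + M $ 2 $ i * z $ 2 + M $ 3 $ i * z $ 3" for z i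
    by (simp add: matrix_vector_mult_3 transpose_def)
  show ?thesis
    unfolding vec_eq_iff forall_3 T by (simp add: matrix_vector_mult_3 det_3 algebra_simps)
qed

lemma inverse_transpose_mult_cross:
  fixes M :: "'a::field ^ 3 ^ 3"
  assumes "invertible M"
  shows "transpose (matrix_inv M) *v cross u v = (1 / det M) *s cross (M *v u) (M *v v)"
proof -
  have M0: "det M \<noteq> 0" using assms by (simp add: invertible_det_nz)
  have "M ** matrix_inv M = mat 1 \<and> matrix_inv M ** M = mat 1"
    unfolding matrix_inv_def using assms unfolding invertible_def by (rule someI_ex)
  then have "transpose (matrix_inv M) ** transpose M = mat 1"
    by (simp flip: matrix_transpose_mul)
  then have "transpose (matrix_inv M) *v (transpose M *v z) = z" for z
    by (simp only: matrix_vector_mul_assoc matrix_vector_mul_lid)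
  from this[of "cross (M *v u) (M *v v)"]
  have "det M *s (transpose (matrix_inv M) *v cross u v) = cross (M *v u) (M *v v)"
    unfolding transpose_mult_cross by (simp add: vec.scale)
  then show ?thesis using M0 by (metis (no_types, lifting) divide_self_if mult.commute times_divide_eq_left vec.scale_one vec.scale_scale mult_1)
qed

lemma bracket_cross_chain:
  "bracket (cross V0 V1) (cross V1 V2) (cross V2 V3) = bracket V0 V1 V2 * bracket V1 V2 V3"
  unfolding bracket_def cross_components by algebra

text \<open>The term \<open>V3\<close> of \<open>V4\<close> drops out of the product, and the term
  \<open>V1\<close> of \<open>V3\<close> drops out of its product with \<open>V1\<close>. The common
  factor \<open>x5\<close> is what the rescaling of the lines has to remove.\<close>

lemma dual_recurrence:
  assumes "V3 = V2 + (- x3) *s V1 + (x1 * x2 * x3) *s V0"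
    "V4 = V3 + (- x5) *s V2 + (x3 * x4 * x5) *s V1"
  shows "cross V3 V4 = x5 *s (cross V2 V3 + (- (x3 * x4)) *s cross V1 V2 +
    (x3 * x4 * (x1 * x2 * x3)) *s cross V0 V1)"
  unfolding assms vec_eq_iff forall_3 by (simp add: algebra_simps)

theorem mainTheorem1:
  fixes n :: nat
    and A :: "int \<Rightarrow> ('a::field ^ 3) set"
    and T :: "('a ^ 3) set \<Rightarrow> ('a ^ 3) set"
    and x :: "nat \<Rightarrow> 'a"
  assumes "n \<ge> 3"
    and "polypoint n A T"
    and "nondegenerate A"
    and "\<And>i. i \<in> {1..2 * n} \<Longrightarrow> x i = proj_invariant A i"
  shows "Omega1 T =
           (\<Sum>k=0..n div 2. pent_O n x k) ^ 3 / ((pent_O n x n)\<^sup>2 * pent_E n x n) \<and>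
         Omega2 T =
           (\<Sum>k=0..n div 2. pent_E n x k) ^ 3 / ((pent_E n x n)\<^sup>2 * pent_O n x n)"
proof
  define X where "X = proj_invariant A"
  have x: "x i = X i" if "i \<in> {1..2 * n}" for i using assms(4) that by (simp add: X_def)
  obtain M c V where M: "is_lift M T" and c: "c \<noteq> 0" "\<And>k. M *v V k = c *s V (k + n)"
    and V: "\<And>k. V (k + 3) = V (k + 2) + (- X (2 * k + 3)) *s V (k + 1) +
      (X (2 * k + 1) * X (2 * k + 2) * X (2 * k + 3)) *s V k"
    and ind: "\<And>k. bracket (V k) (V (k + 1)) (V (k + 2)) \<noteq> 0"
    and X: "\<And>i. X (i + 2 * n) = X i" "\<And>k. X (2 * k + 1) \<noteq> 0"
    by (rule obtain_polypoint_recurrence[OF assms(2,3), folded X_def]) (rule that)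
  have pos: "pos 0 k = 2 * k + 1" "2 * k + 1 + 1 = 2 * k + 2" "2 * k + 1 + 2 = 2 * k + 3"
    "pos 1 k = 2 * k + 2" "2 * k + 2 + 1 = 2 * k + 3" "2 * k + 2 + 2 = 2 * k + 4" for k
    by (simp_all add: pos_def)
  have parity: "(\<lambda>i. odd (i + 0)) = odd" "(\<lambda>i. even (i + 0)) = even"
    "(\<lambda>i. odd (i + 1)) = even" "(\<lambda>i. even (i + 1)) = odd" for i by auto
  let ?N = "scale_matrix (inverse c) M"
  have N: "?N *v V k = V (k + n)" for k using c by (simp add: scale_matrix_mult)
  have V0: "V (k + 3) = V (k + 2) + (- X (pos 0 k + 2)) *s V (k + 1) +
      (X (pos 0 k) * X (pos 0 k + 1) * X (pos 0 k + 2)) *s V k" for k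
    unfolding pos by (rule V)
  have "Omega1 T = trace ?N ^ 3 / det ?N"
    using Omega1_eq[OF M] trace_det_scale_matrix[of "inverse c" M] c(1) by simp
  also have "trace ?N = (\<Sum>k=0..n div 2. pent_O n x k)"
    using trace_pent_invariants[where s = 0, OF assms(1) _ X(1) x V0 N ind] unfolding parity by simp
  also have "det ?N = (pent_O n x n)\<^sup>2 * pent_E n x n"
    using det_pent_invariants[where s = 0, OF assms(1) _ X(1) x V0 N ind] unfolding parity by simp
  finally show "Omega1 T = (\<Sum>k=0..n div 2. pent_O n x k) ^ 3 / ((pent_O n x n)\<^sup>2 * pent_E n x n)" .
  \<comment> \<open>Passing from \<open>l (k + 2)\<close> to \<open>l (k + 3)\<close> contributes
    exactly the factor \<open>X (2 * k + 5)\<close> of \<open>dual_recurrence\<close>, so the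
    leading coefficient becomes 1 and the others become the invariants shifted by one.\<close>
  define l where "l k = (\<Prod>i<k. X (2 * i + 1))" for k
  have l: "l k \<noteq> 0" "l (k + 1) = X (2 * k + 1) * l k" for k using X(2) by (simp_all add: l_def)
  have ln: "l (k + n) = l n * l k" for k
  proof (induction k)
    case (Suc k)
    have "2 * (k + n) + 1 = 2 * k + 1 + 2 * n" by simp
    then show ?case using l(2)[of k] l(2)[of "k + n"] X(1)[of "2 * k + 1"] Suc by simp
  qed (simp add: l_def)
  define W where "W k = cross (V k) (V (k + 1))" for k
  define Z where "Z k = inverse (l k) *s W k" for k
  \<comment> \<open>Two lifts contribute \<open>c\<^sup>2\<close>, the inverse transpose contributes
    the inverse of \<open>det M\<close>, and the rescaling contributes \<open>l n\<close>, which is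
    independent of \<open>k\<close> by periodicity.\<close>
  define r where "r = c\<^sup>2 * l n / det M"
  have inv: "invertible M" using M by (simp add: is_lift_def)
  then have M0: "det M \<noteq> 0" by (simp add: invertible_det_nz)
  have r: "r \<noteq> 0" using c(1) M0 l(1) by (simp add: r_def)
  let ?N' = "scale_matrix (inverse r) (transpose (matrix_inv M))"
  have N': "?N' *v Z k = Z (k + n)" for k
  proof -
    have "k + 1 + n = k + n + 1" by simp
    then have "transpose (matrix_inv M) *v W k = (c\<^sup>2 / det M) *s W (k + n)"
      unfolding W_def inverse_transpose_mult_cross[OF inv] c(2) cross_scale
      by (simp add: power2_eq_square)
    then show ?thesis
      using c(1) M0 l(1) by (simp add: scale_matrix_mult Z_def vec.scale ln r_def field_simps)
  qed
  have ind': "bracket (Z k) (Z (k + 1)) (Z (k + 2)) \<noteq> 0" for k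
  proof -
    have "bracket (W k) (W (k + 1)) (W (k + 2)) =
        bracket (V k) (V (k + 1)) (V (k + 2)) * bracket (V (k + 1)) (V (k + 2)) (V (k + 3))"
      unfolding W_def by (simp add: bracket_cross_chain[symmetric] numeral_3_eq_3 numeral_2_eq_2)
    then show ?thesis using ind[of k] ind[of "k + 1"] l(1)
      by (simp add: Z_def numeral_3_eq_3 numeral_2_eq_2)
  qed
  have Z: "Z (k + 3) = Z (k + 2) + (- X (pos 1 k + 2)) *s Z (k + 1) +
      (X (pos 1 k) * X (pos 1 k + 1) * X (pos 1 k + 2)) *s Z k" for k
  proof -
    have k: "k + 1 + 1 = k + 2" "k + 1 + 2 = k + 3" "k + 1 + 3 = k + 4" "k + 2 + 1 = k + 3" "k + 3 + 1 = k + 4"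
      "2 * (k + 1) + 1 = 2 * k + 3" "2 * (k + 1) + 2 = 2 * k + 4" "2 * (k + 1) + 3 = 2 * k + 5"
      "2 * (k + 2) + 1 = 2 * k + 5" by simp_all
    have W: "W (k + 3) = X (2 * k + 5) *s (W (k + 2) + (- (X (2 * k + 3) * X (2 * k + 4))) *s W (k + 1) +
        (X (2 * k + 3) * X (2 * k + 4) * (X (2 * k + 1) * X (2 * k + 2) * X (2 * k + 3))) *s W k)"
      unfolding W_def k by (rule dual_recurrence[OF V V[of "k + 1", unfolded k]])
    have lk: "l (k + 1) = X (2 * k + 1) * l k" "l (k + 2) = X (2 * k + 3) * (X (2 * k + 1) * l k)"
      "l (k + 3) = X (2 * k + 5) * (X (2 * k + 3) * (X (2 * k + 1) * l k))"
      using l(2)[of k] l(2)[of "k + 1"] l(2)[of "k + 2"] unfolding k by simp_all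
    have "X (2 * k + 1) \<noteq> 0" "X (2 * k + 3) \<noteq> 0" "X (2 * k + 5) \<noteq> 0"
      using X(2)[of k] X(2)[of "k + 1"] X(2)[of "k + 2"] unfolding k by simp_all
    then show ?thesis unfolding Z_def W lk pos using l(1)[of k]
      by (simp add: vec.scale_right_distrib field_simps)
  qed
  have "Omega2 T = trace ?N' ^ 3 / det ?N'"
    using Omega2_eq[OF M] trace_det_scale_matrix[of "inverse r"] r by simp
  also have "trace ?N' = (\<Sum>k=0..n div 2. pent_E n x k)"
    using trace_pent_invariants[where s = 1, OF assms(1) _ X(1) x Z N' ind'] unfolding parity by simp
  also have "det ?N' = (pent_E n x n)\<^sup>2 * pent_O n x n"
    using det_pent_invariants[where s = 1, OF assms(1) _ X(1) x Z N' ind'] unfolding parity by simp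
  finally show "Omega2 T = (\<Sum>k=0..n div 2. pent_E n x k) ^ 3 / ((pent_E n x n)\<^sup>2 * pent_O n x n)" .
qed

end
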